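(* Assume that $\mathrm{Tr}(e^{-tD^2})\stackrel{t\to0}{\sim}f(-\log t)\,t^\alpha$, where $\alpha<0$ and $f:\mathbb R^{\ge0}\to\mathbb R$ is a bounded, locally integrable function for which $\lim_{s\to0^+}s\mathcal L[f](s)$ exists and is non-zero. If $A\in\mathcal B(\mathfrak H)$ is strongly regular with constant $c_A$, then $c_A=\mathcal T(A)$; that is, $\mathrm{Tr}(e^{-tD^2}A)=\mathcal T(A)\,\mathrm{Tr}(e^{-tD^2})+o(\mathrm{Tr}(e^{-tD^2}))$ as $t\to0^+$, so that $\mathrm{Tr}(e^{-tD^2}A)\stackrel{t\to0}{\sim}\mathcal T(A)\mathrm{Tr}(e^{-tD^2})$ if $\mathcal T(A)\ne0$. In other words, one has $\mathrm{Tr}(e^{-tD^2}A)=f_A(-\log t)t^\alpha+o(\mathrm{Tr}(e^{-tD^2}))$ with $f_A=\mathcal T(A)f$.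
   Context: $(\mathcal A,\mathfrak H,D)$ is a spectral triple; in particular $D$ is self-adjoint on the Hilbert space $\mathfrak H$, assumed invertible with compact inverse, and $e^{-tD^2}$ is trace class for all $t>0$. $A\in\mathcal B(\mathfrak H)$ is strongly regular if there exists a number $c_A$ such that $\mathrm{Tr}(e^{-tD^2}A)-c_A\mathrm{Tr}(e^{-tD^2})=o(\mathrm{Tr}(e^{-tD^2}))$ as $t\to0^+$. $\mathcal T(A)=\lim_{s\to s_0^+}\mathrm{Tr}(|D|^{-s}A)/\zeta(s)$, where $\zeta(s)=\mathrm{Tr}(|D|^{-s})$ has abscissa of convergence $s_0$. $\mathcal L[f](s)=\int_0^\infty f(x)e^{-sx}dx$. $g_1\stackrel{t\to0}{\sim}g_2$ means $|g_1-g_2|=o(|g_2|)$ as $t\to0^+$. *)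

theory Defs
  imports "HOL-Analysis.Analysis" "HOL-Library.Landau_Symbols"
begin

section \<open>Complex Hilbert spaces and bounded operators\<close>

text \<open>The inner product is antilinear in its first argument.\<close>

class complex_hilbert_space = banach +
  fixes scaleC :: "complex \<Rightarrow> 'a \<Rightarrow> 'a"  (infixr "*\<^sub>C" 75)
    and cinner :: "'a \<Rightarrow> 'a \<Rightarrow> complex"
  assumes scaleC_add_right: "c *\<^sub>C (x + y) = c *\<^sub>C x + c *\<^sub>C y"
    and scaleC_add_left: "(c + d) *\<^sub>C x = c *\<^sub>C x + d *\<^sub>C x"
    and scaleC_scaleC: "c *\<^sub>C (d *\<^sub>C x) = (c * d) *\<^sub>C x"
    and scaleR_eq_scaleC: "r *\<^sub>R x = complex_of_real r *\<^sub>C x"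
    and cinner_commute: "cinner x y = cnj (cinner y x)"
    and cinner_add_right: "cinner x (y + z) = cinner x y + cinner x z"
    and cinner_scaleC_right: "cinner x (c *\<^sub>C y) = c * cinner x y"
    and cinner_self: "cinner x x = complex_of_real ((norm x)\<^sup>2)"

definition csubspace :: "'h::complex_hilbert_space set \<Rightarrow> bool" where
  "csubspace V \<longleftrightarrow> 0 \<in> V \<and> (\<forall>x\<in>V. \<forall>y\<in>V. x + y \<in> V) \<and> (\<forall>c. \<forall>x\<in>V. c *\<^sub>C x \<in> V)"

definition clinear_on :: "'h set \<Rightarrow> ('h \<Rightarrow> 'h::complex_hilbert_space) \<Rightarrow> bool" where
  "clinear_on V T \<longleftrightarrow>
     (\<forall>x\<in>V. \<forall>y\<in>V. T (x + y) = T x + T y) \<and> (\<forall>c. \<forall>x\<in>V. T (c *\<^sub>C x) = c *\<^sub>C T x)"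

definition bounded_clinear :: "('h \<Rightarrow> 'h::complex_hilbert_space) \<Rightarrow> bool" where
  "bounded_clinear T \<longleftrightarrow> bounded_linear T \<and> (\<forall>c x. T (c *\<^sub>C x) = c *\<^sub>C T x)"

definition adjoint_op :: "('h \<Rightarrow> 'h) \<Rightarrow> 'h \<Rightarrow> 'h::complex_hilbert_space" where
  "adjoint_op T = (THE S. bounded_clinear S \<and> (\<forall>x y. cinner (S x) y = cinner x (T y)))"

definition positive_op :: "('h \<Rightarrow> 'h::complex_hilbert_space) \<Rightarrow> bool" where
  "positive_op P \<longleftrightarrow> bounded_clinear P \<and> (\<forall>x. cinner x (P x) \<in> \<real>\<^sub>\<ge>\<^sub>0)"

definition abs_op :: "('h \<Rightarrow> 'h) \<Rightarrow> 'h \<Rightarrow> 'h::complex_hilbert_space" where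
  "abs_op T = (THE P. positive_op P \<and> P \<circ> P = adjoint_op T \<circ> T)"

definition compact_op :: "('h \<Rightarrow> 'h::complex_hilbert_space) \<Rightarrow> bool" where
  "compact_op T \<longleftrightarrow> bounded_clinear T \<and> compact (closure (T ` cball 0 1))"

section \<open>Trace class and trace\<close>

text \<open>Orthonormal bases are complete orthonormal systems (Hilbert bases).\<close>

definition is_onb :: "'h::complex_hilbert_space set \<Rightarrow> bool" where
  "is_onb B \<longleftrightarrow> (\<forall>e\<in>B. norm e = 1) \<and> (\<forall>e\<in>B. \<forall>e'\<in>B. e \<noteq> e' \<longrightarrow> cinner e e' = 0)
     \<and> (\<forall>x. (\<forall>e\<in>B. cinner e x = 0) \<longrightarrow> x = 0)"

definition trace_class :: "('h \<Rightarrow> 'h::complex_hilbert_space) \<Rightarrow> bool" where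
  "trace_class T \<longleftrightarrow> bounded_clinear T \<and>
     (\<exists>B. is_onb B \<and> (\<lambda>e. cinner e (abs_op T e)) summable_on B)"

text \<open>For a trace class operator the sum does not depend on the choice of the basis; the
  definition is meant for such operators only.\<close>

definition op_trace :: "('h \<Rightarrow> 'h::complex_hilbert_space) \<Rightarrow> complex" where
  "op_trace T = (\<Sum>\<^sub>\<infinity>e\<in>(SOME B. is_onb B). cinner e (T e))"

section \<open>Unbounded self-adjoint operators\<close>

text \<open>An unbounded operator is given by its domain \<open>V\<close> and a function \<open>D\<close> whose values outside
  \<open>V\<close> are irrelevant. Self-adjointness \<open>D\<^sup>* = D\<close> (including equality of the domains) is
  expressed as equality of graphs.\<close>

definition op_graph :: "'h set \<Rightarrow> ('h \<Rightarrow> 'h) \<Rightarrow> ('h \<times> 'h) set" where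
  "op_graph V D = {(x, D x) | x. x \<in> V}"

definition adjoint_graph :: "'h set \<Rightarrow> ('h \<Rightarrow> 'h::complex_hilbert_space) \<Rightarrow> ('h \<times> 'h) set" where
  "adjoint_graph V D = {(y, z). \<forall>x\<in>V. cinner y (D x) = cinner z x}"

definition self_adjoint :: "'h set \<Rightarrow> ('h \<Rightarrow> 'h::complex_hilbert_space) \<Rightarrow> bool" where
  "self_adjoint V D \<longleftrightarrow> csubspace V \<and> closure V = UNIV \<and> clinear_on V D \<and>
     adjoint_graph V D = op_graph V D"

definition compact_inverse :: "'h set \<Rightarrow> ('h \<Rightarrow> 'h::complex_hilbert_space) \<Rightarrow> bool" where
  "compact_inverse V D \<longleftrightarrow> bij_betw D V UNIV \<and> compact_op (inv_into V D)"

definition compact_resolvent :: "'h set \<Rightarrow> ('h \<Rightarrow> 'h::complex_hilbert_space) \<Rightarrow> bool" where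
  "compact_resolvent V D \<longleftrightarrow> (\<exists>z. compact_inverse V (\<lambda>x. D x - z *\<^sub>C x))"

text \<open>Functional calculus for a self-adjoint operator with compact resolvent. Its spectral measure
  is concentrated on the (real) eigenvalues and the eigenvectors span a dense subspace, so \<open>g(D)\<close>
  is the bounded operator that acts on the eigenspace of each eigenvalue \<open>l\<close> as multiplication
  by \<open>g l\<close>. It is used for \<open>g\<close> bounded on the spectrum only.\<close>

definition op_fun :: "'h set \<Rightarrow> ('h \<Rightarrow> 'h) \<Rightarrow> (real \<Rightarrow> real) \<Rightarrow> 'h \<Rightarrow> 'h::complex_hilbert_space" where
  "op_fun V D g = (THE T. bounded_clinear T \<and>
     (\<forall>l. \<forall>x\<in>V. D x = l *\<^sub>R x \<longrightarrow> T x = g l *\<^sub>R x))"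

text \<open>\<open>heat_op V D t\<close> is \<open>e\<^sup>-\<^sup>t\<^sup>D\<^sup>2\<close> and \<open>abs_power V D s\<close> is \<open>|D|\<^sup>-\<^sup>s\<close>.\<close>

definition heat_op :: "'h set \<Rightarrow> ('h \<Rightarrow> 'h) \<Rightarrow> real \<Rightarrow> 'h \<Rightarrow> 'h::complex_hilbert_space" where
  "heat_op V D t = op_fun V D (\<lambda>l. exp (- t * l\<^sup>2))"

definition abs_power :: "'h set \<Rightarrow> ('h \<Rightarrow> 'h) \<Rightarrow> real \<Rightarrow> 'h \<Rightarrow> 'h::complex_hilbert_space" where
  "abs_power V D s = op_fun V D (\<lambda>l. \<bar>l\<bar> powr (- s))"

section \<open>Spectral triples\<close>

text \<open>The algebra is identified with its image under its faithful representation, that is, it is a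
  star-algebra of bounded operators. Only a norm-dense set of its elements is required to have
  bounded commutators with \<open>D\<close>; this covers both the convention with a C*-algebra and the one with
  an algebra all of whose elements have bounded commutators.\<close>

definition star_algebra :: "('h \<Rightarrow> 'h::complex_hilbert_space) set \<Rightarrow> bool" where
  "star_algebra \<A> \<longleftrightarrow> (\<forall>a\<in>\<A>. bounded_clinear a) \<and> (\<lambda>x. 0) \<in> \<A> \<and>
     (\<forall>a\<in>\<A>. \<forall>b\<in>\<A>. (\<lambda>x. a x + b x) \<in> \<A> \<and> a \<circ> b \<in> \<A>) \<and>
     (\<forall>c. \<forall>a\<in>\<A>. (\<lambda>x. c *\<^sub>C a x) \<in> \<A>) \<and> (\<forall>a\<in>\<A>. adjoint_op a \<in> \<A>)"

definition bounded_commutator :: "'h set \<Rightarrow> ('h \<Rightarrow> 'h) \<Rightarrow> ('h \<Rightarrow> 'h::complex_hilbert_space) \<Rightarrow> bool" where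
  "bounded_commutator V D a \<longleftrightarrow> a ` V \<subseteq> V \<and>
     (\<exists>K. \<forall>x\<in>V. norm (D (a x) - a (D x)) \<le> K * norm x)"

definition spectral_triple :: "('h \<Rightarrow> 'h) set \<Rightarrow> 'h set \<Rightarrow> ('h \<Rightarrow> 'h::complex_hilbert_space) \<Rightarrow> bool" where
  "spectral_triple \<A> V D \<longleftrightarrow> star_algebra \<A> \<and> self_adjoint V D \<and> compact_resolvent V D \<and>
     (\<forall>a\<in>\<A>. \<forall>\<epsilon>>0. \<exists>b\<in>\<A>. bounded_commutator V D b \<and> onorm (\<lambda>x. a x - b x) < \<epsilon>)"

section \<open>Zeta function, strong regularity, Laplace transform\<close>

definition spec_zeta :: "'h set \<Rightarrow> ('h \<Rightarrow> 'h::complex_hilbert_space) \<Rightarrow> real \<Rightarrow> complex" where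
  "spec_zeta V D s = op_trace (abs_power V D s)"

text \<open>The restriction to \<open>s > 0\<close> guarantees that \<open>|D|\<^sup>-\<^sup>s\<close> is bounded. It is no loss: on an
  infinite-dimensional space \<open>|D|\<^sup>-\<^sup>s\<close> is not trace class for \<open>s \<le> 0\<close>.\<close>

definition zeta_abscissa :: "'h set \<Rightarrow> ('h \<Rightarrow> 'h::complex_hilbert_space) \<Rightarrow> real" where
  "zeta_abscissa V D = Inf {s. 0 < s \<and> trace_class (abs_power V D s)}"

definition zeta_quotient ::
    "'h set \<Rightarrow> ('h \<Rightarrow> 'h) \<Rightarrow> ('h \<Rightarrow> 'h::complex_hilbert_space) \<Rightarrow> real \<Rightarrow> complex" where
  "zeta_quotient V D A s = op_trace (abs_power V D s \<circ> A) / spec_zeta V D s"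

text \<open>The number \<open>\<T>(A)\<close>, meaningful when the limit exists.\<close>

definition spec_state :: "'h set \<Rightarrow> ('h \<Rightarrow> 'h) \<Rightarrow> ('h \<Rightarrow> 'h::complex_hilbert_space) \<Rightarrow> complex" where
  "spec_state V D A = Lim (at_right (zeta_abscissa V D)) (zeta_quotient V D A)"

text \<open>Strong regularity of a bounded operator \<open>A\<close>, with constant \<open>c\<close>.\<close>

definition strongly_regular ::
    "'h set \<Rightarrow> ('h \<Rightarrow> 'h) \<Rightarrow> ('h \<Rightarrow> 'h::complex_hilbert_space) \<Rightarrow> complex \<Rightarrow> bool" where
  "strongly_regular V D A c \<longleftrightarrow>
     (\<lambda>t. op_trace (heat_op V D t \<circ> A) - c * op_trace (heat_op V D t))
       \<in> o[at_right 0](\<lambda>t. op_trace (heat_op V D t))"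

definition laplace :: "(real \<Rightarrow> real) \<Rightarrow> real \<Rightarrow> real" where
  "laplace f s = (LINT x:{0..}|lebesgue. f x * exp (- s * x))"

end

theory Submission
  imports Defs
begin

text \<open>Since \<open>D\<^sup>-\<^sup>1\<close> is compact and symmetric, there is an orthonormal basis of eigenvectors \<open>e\<close> of
  \<open>D\<close> with eigenvalues \<open>l e\<close> bounded away from zero, and all traces are sums over it:
  \<open>Tr(g(D) A) = \<Sum>\<^sub>e g(l e) \<langle>e, A e\<rangle>\<close>. The Mellin transform turns \<open>e\<^sup>-\<^sup>t\<^sup>D\<^sup>2\<close> into \<open>\<Gamma>(s/2) |D|\<^sup>-\<^sup>s\<close>; it is
  used with \<open>t = exp (- x)\<close>, where rescaling an eigenvalue becomes a translation of \<open>x\<close>. As \<open>f\<close> is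
  bounded, \<open>\<zeta>(s)\<close> converges for \<open>s > -2 \<alpha>\<close>, and \<open>u L[f](u) \<rightarrow> L \<noteq> 0\<close> with \<open>u = s/2 + \<alpha>\<close> forces \<open>\<zeta>(s)\<close>
  to tend to infinity at \<open>-2 \<alpha>\<close>, which is therefore the abscissa of convergence. In the Mellin
  integral of \<open>Tr(e\<^sup>-\<^sup>t\<^sup>D\<^sup>2 A) - c Tr(e\<^sup>-\<^sup>t\<^sup>D\<^sup>2)\<close> small \<open>t\<close> contributes at most \<open>\<epsilon> \<Gamma>(s/2) \<zeta>(s)\<close> by strong
  regularity and large \<open>t\<close> a bounded amount, so division by \<open>\<Gamma>(s/2) \<zeta>(s)\<close> gives the limit \<open>c\<close>.\<close>

section \<open>Orthonormal bases in complex Hilbert spaces\<close>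

text \<open>The definitions decide where the operator theory lies. \<open>op_trace\<close> sums over
  a basis fixed by choice and \<open>trace_class\<close> only asserts that some basis works, so sums
  over eigenvectors become available only through basis independence for g(D) A.
  \<open>op_fun\<close> and \<open>abs_op\<close> are definite descriptions, so existence and
  uniqueness have to be supplied; both are proved directly for diagonal operators. On the analytic
  side, f may oscillate and come arbitrarily close to zero, so the heat trace has no pointwise lower
  bound of order \<open>t powr \<alpha>\<close>; only a Laplace mean of f is known to be large.
  Divergence of the zeta function is therefore read off from an inequality between integrals, and no
  residue is computed. Divergence is enough, because the claim concerns a quotient in which the
  Gamma factor cancels and every bounded contribution disappears. Large t contributes a bounded
  amount because the eigenvalues of the square of D stay away from zero, which makes the heat series
  decay exponentially.\<close>

lemma cinner_add_left: "cinner (x + y) z = cinner x z + cinner (y::'h::complex_hilbert_space) z"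
  by (metis cinner_add_right cinner_commute complex_cnj_add)

lemma cinner_scaleC_left: "cinner (c *\<^sub>C x) y = cnj c * cinner (x::'h::complex_hilbert_space) y"
  by (metis cinner_commute cinner_scaleC_right complex_cnj_mult)

lemma scaleC_zero_left [simp]: "0 *\<^sub>C x = (0::'h::complex_hilbert_space)"
  by (metis of_real_0 scaleR_eq_scaleC scaleR_zero_left)

lemma scaleC_minus_one: "(- 1) *\<^sub>C x = - (x::'h::complex_hilbert_space)"
  by (metis of_real_1 of_real_minus scaleR_eq_scaleC scaleR_minus1_left)

lemma cinner_zero_right [simp]: "cinner x 0 = (0::complex)"
  by (metis cinner_scaleC_right mult_zero_left scaleC_zero_left)

lemma cinner_zero_left [simp]: "cinner 0 x = (0::complex)"
  by (metis cinner_commute cinner_zero_right complex_cnj_zero)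

lemma cinner_minus_right: "cinner x (- y) = - cinner x (y::'h::complex_hilbert_space)"
  by (metis cinner_scaleC_right scaleC_minus_one mult_minus1)

lemma cinner_diff_right: "cinner x (y - z) = cinner x y - cinner x (z::'h::complex_hilbert_space)"
  by (metis cinner_add_right cinner_minus_right diff_conv_add_uminus)

lemma cinner_diff_left: "cinner (x - y) z = cinner x z - cinner (y::'h::complex_hilbert_space) z"
  by (metis cinner_commute cinner_diff_right complex_cnj_diff)

lemma cinner_sum_right:
  "cinner (x::'h::complex_hilbert_space) (\<Sum>i\<in>F. f i) = (\<Sum>i\<in>F. cinner x (f i))"
  by (induction F rule: infinite_finite_induct) (auto simp: cinner_add_right)

lemma cinner_sum_left:
  "cinner (\<Sum>i\<in>F. f i) (x::'h::complex_hilbert_space) = (\<Sum>i\<in>F. cinner (f i) x)"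
  by (induction F rule: infinite_finite_induct) (auto simp: cinner_add_left)

lemma cnj_mult_self: "cnj z * z = complex_of_real ((cmod z)\<^sup>2)"
  by (metis complex_norm_square mult.commute)

lemma norm_scaleC: "norm (c *\<^sub>C x) = cmod c * norm (x::'h::complex_hilbert_space)"
proof -
  have "complex_of_real ((norm (c *\<^sub>C x))\<^sup>2) = (cnj c * c) * cinner x x"
    unfolding cinner_self[symmetric] cinner_scaleC_left cinner_scaleC_right by simp
  also have "\<dots> = complex_of_real ((cmod c * norm x)\<^sup>2)"
    unfolding cnj_mult_self cinner_self by (simp add: power_mult_distrib)
  finally have "(norm (c *\<^sub>C x))\<^sup>2 = (cmod c * norm x)\<^sup>2"
    unfolding of_real_eq_iff .
  then show ?thesis
    by (rule power2_eq_imp_eq) auto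
qed

text \<open>Separated from \<open>is_onb\<close> because Bessel's inequality is applied to finite
  subsets and Zorn's lemma to systems not yet known to be complete.\<close>

definition orthonormal :: "'h::complex_hilbert_space set \<Rightarrow> bool" where
  "orthonormal B \<longleftrightarrow>
     (\<forall>e\<in>B. norm e = 1) \<and> (\<forall>e\<in>B. \<forall>e'\<in>B. e \<noteq> e' \<longrightarrow> cinner e e' = 0)"

lemma is_onb_iff:
  "is_onb B \<longleftrightarrow> orthonormal B \<and> (\<forall>x. (\<forall>e\<in>B. cinner e x = 0) \<longrightarrow> x = 0)"
  by (auto simp: is_onb_def orthonormal_def)

lemma orthonormal_subset: "orthonormal B \<Longrightarrow> C \<subseteq> B \<Longrightarrow> orthonormal C"
  by (auto simp: orthonormal_def)

lemma cinner_orthonormal: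
  "orthonormal B \<Longrightarrow> e \<in> B \<Longrightarrow> e' \<in> B \<Longrightarrow> cinner e e' = (if e = e' then 1 else 0)"
  by (auto simp: orthonormal_def cinner_self)

lemma cinner_orthonormal_sum:
  assumes "orthonormal B" "finite F" "F \<subseteq> B" "e \<in> B"
  shows "cinner e (\<Sum>e'\<in>F. a e' *\<^sub>C e') = (if e \<in> F then a e else 0)"
proof -
  have "cinner e (\<Sum>e'\<in>F. a e' *\<^sub>C e') = (\<Sum>e'\<in>F. if e = e' then a e' else 0)"
    unfolding cinner_sum_right cinner_scaleC_right
    by (intro sum.cong) (use assms in \<open>auto simp: cinner_orthonormal\<close>)
  then show ?thesis
    using assms by simp
qed

lemma norm_orthonormal_sum:
  assumes "orthonormal F" "finite F"
  shows "(norm (\<Sum>e\<in>F. a e *\<^sub>C e))\<^sup>2 = (\<Sum>e\<in>F. (cmod (a e))\<^sup>2)"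
proof -
  have "complex_of_real ((norm (\<Sum>e\<in>F. a e *\<^sub>C e))\<^sup>2)
      = (\<Sum>e\<in>F. cnj (a e) * cinner e (\<Sum>e\<in>F. a e *\<^sub>C e))"
    unfolding cinner_self[symmetric] by (subst (1) cinner_sum_left) (simp add: cinner_scaleC_left)
  also have "\<dots> = (\<Sum>e\<in>F. cnj (a e) * a e)"
    by (intro sum.cong) (use assms in \<open>auto simp: cinner_orthonormal_sum\<close>)
  also have "\<dots> = complex_of_real (\<Sum>e\<in>F. (cmod (a e))\<^sup>2)"
    by (simp only: cnj_mult_self of_real_sum)
  finally show ?thesis
    using of_real_eq_iff by blast
qed

text \<open>With \<open>y\<close> the projection of \<open>x\<close> onto the span of
  \<open>F\<close>, both \<open>cinner y x\<close> and \<open>cinner y y\<close> equal the sum of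
  squares; expanding the squared norm of \<open>x - y\<close> leaves exactly the difference of the
  two sides.\<close>

lemma bessel_finite:
  assumes "orthonormal F" "finite F"
  shows "(\<Sum>e\<in>F. (cmod (cinner e x))\<^sup>2) \<le> (norm x)\<^sup>2"
proof -
  define y where "y = (\<Sum>e\<in>F. cinner e x *\<^sub>C e)"
  have yx: "cinner y x = complex_of_real (\<Sum>e\<in>F. (cmod (cinner e x))\<^sup>2)"
    unfolding y_def cinner_sum_left cinner_scaleC_left cnj_mult_self of_real_sum ..
  have yy: "cinner y y = complex_of_real (\<Sum>e\<in>F. (cmod (cinner e x))\<^sup>2)"
    unfolding cinner_self y_def by (subst norm_orthonormal_sum[OF assms]) simp
  have "complex_of_real ((norm (x - y))\<^sup>2) = cinner x x - cinner x y - (cinner y x - cinner y y)"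
    unfolding cinner_self[symmetric] by (simp add: cinner_diff_left cinner_diff_right)
  also have "\<dots> = complex_of_real ((norm x)\<^sup>2 - (\<Sum>e\<in>F. (cmod (cinner e x))\<^sup>2))"
    unfolding yx yy using cinner_commute[of x y] yx by (simp add: cinner_self)
  finally have "(norm (x - y))\<^sup>2 = (norm x)\<^sup>2 - (\<Sum>e\<in>F. (cmod (cinner e x))\<^sup>2)"
    using of_real_eq_iff by blast
  then show ?thesis
    by (smt (verit) zero_le_power2)
qed

lemma cauchy_schwarz: "cmod (cinner x y) \<le> norm x * norm (y::'h::complex_hilbert_space)"
proof (cases "x = 0")
  case False
  define e where "e = complex_of_real (inverse (norm x)) *\<^sub>C x"
  have "norm e = 1"
    using False by (simp add: e_def norm_scaleC norm_inverse)
  then have "(cmod (cinner e y))\<^sup>2 \<le> (norm y)\<^sup>2"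
    using bessel_finite[of "{e}" y] by (simp add: orthonormal_def)
  then have "cmod (cinner e y) \<le> norm y"
    using norm_ge_zero power2_le_imp_le by blast
  moreover have "cmod (cinner e y) = inverse (norm x) * cmod (cinner x y)"
    by (simp add: e_def cinner_scaleC_left norm_mult norm_inverse)
  ultimately show ?thesis
    using False by (simp add: field_simps)
qed simp

lemma bounded_linear_cinner: "bounded_linear (cinner (x::'h::complex_hilbert_space))"
proof (rule bounded_linear_intro[where K = "norm x"])
  show "cinner x (r *\<^sub>R y) = r *\<^sub>R cinner x y" for r y
    by (simp add: scaleR_eq_scaleC cinner_scaleC_right scaleR_conv_of_real)
  show "norm (cinner x y) \<le> norm y * norm x" for y
    using cauchy_schwarz[of x y] by (simp add: mult.commute)
qed (rule cinner_add_right)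

lemma bounded_linear_if_bounded_clinear: "bounded_clinear T \<Longrightarrow> bounded_linear T"
  unfolding bounded_clinear_def by (rule conjunct1)

lemma bounded_clinear_scaleC: "bounded_clinear T \<Longrightarrow> T (c *\<^sub>C x) = c *\<^sub>C T x"
  unfolding bounded_clinear_def by blast

lemma bessel_summable:
  assumes "orthonormal B"
  shows "(\<lambda>e. (cmod (cinner e x))\<^sup>2) summable_on B"
proof (rule nonneg_bdd_above_summable_on)
  show "bdd_above (sum (\<lambda>e. (cmod (cinner e x))\<^sup>2) ` {F. F \<subseteq> B \<and> finite F})"
    by (intro bdd_aboveI2[of _ _ "(norm x)\<^sup>2"] bessel_finite)
       (auto intro: orthonormal_subset[OF assms])
qed auto

text \<open>Riesz-Fischer. By Pythagoras the squared distance of two nested partial sums is a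
  difference of partial sums of the squares, so once \<open>F0\<close> captures all but
  \<open>(\<epsilon> / 2)\<^sup>2\<close> of the total, all larger partial sums lie within
  \<epsilon> of each other, and completeness applies.\<close>

lemma orthonormal_summable:
  assumes B: "orthonormal B" and a: "(\<lambda>e. (cmod (a e))\<^sup>2) summable_on B"
  shows "(\<lambda>e. a e *\<^sub>C e) summable_on B"
proof -
  define S where "S = infsum (\<lambda>e. (cmod (a e))\<^sup>2) B"
  have "\<exists>P. eventually P (finite_subsets_at_top B) \<and>
          (\<forall>F F'. P F \<and> P F' \<longrightarrow> dist (\<Sum>e\<in>F. a e *\<^sub>C e) (\<Sum>e\<in>F'. a e *\<^sub>C e) < \<epsilon>)" if "\<epsilon> > 0" for \<epsilon>
  proof -
    have pos: "(\<epsilon> / 2)\<^sup>2 > 0"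
      using that by simp
    have "((\<lambda>F. \<Sum>e\<in>F. (cmod (a e))\<^sup>2) \<longlongrightarrow> S) (finite_subsets_at_top B)"
      using has_sum_infsum[OF a] by (simp add: has_sum_def S_def)
    then have "\<forall>\<^sub>F F in finite_subsets_at_top B. S - (\<epsilon> / 2)\<^sup>2 < (\<Sum>e\<in>F. (cmod (a e))\<^sup>2)"
      by (rule order_tendstoD) (use pos in simp)
    then obtain F0 where F0: "finite F0" "F0 \<subseteq> B" "S - (\<epsilon> / 2)\<^sup>2 < (\<Sum>e\<in>F0. (cmod (a e))\<^sup>2)"
      unfolding eventually_finite_subsets_at_top by blast
    have near: "dist (\<Sum>e\<in>F. a e *\<^sub>C e) (\<Sum>e\<in>F0. a e *\<^sub>C e) < \<epsilon> / 2"
      if F: "finite F" "F0 \<subseteq> F" "F \<subseteq> B" for F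
    proof -
      have "(\<Sum>e\<in>F. a e *\<^sub>C e) - (\<Sum>e\<in>F0. a e *\<^sub>C e) = (\<Sum>e\<in>F - F0. a e *\<^sub>C e)"
        using F by (simp add: sum_diff)
      moreover have "(norm (\<Sum>e\<in>F - F0. a e *\<^sub>C e))\<^sup>2 = (\<Sum>e\<in>F - F0. (cmod (a e))\<^sup>2)"
        using F orthonormal_subset[OF B, of "F - F0"] by (intro norm_orthonormal_sum) auto
      moreover have "(\<Sum>e\<in>F - F0. (cmod (a e))\<^sup>2)
          = (\<Sum>e\<in>F. (cmod (a e))\<^sup>2) - (\<Sum>e\<in>F0. (cmod (a e))\<^sup>2)"
        using F by (simp add: sum_diff)
      moreover have "(\<Sum>e\<in>F. (cmod (a e))\<^sup>2) \<le> S"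
        unfolding S_def using F by (intro finite_sum_le_infsum[OF a]) auto
      ultimately have "(dist (\<Sum>e\<in>F. a e *\<^sub>C e) (\<Sum>e\<in>F0. a e *\<^sub>C e))\<^sup>2 < (\<epsilon> / 2)\<^sup>2"
        using F0(3) by (simp only: dist_norm)
      then show ?thesis
        by (rule power2_less_imp_less) (use \<open>\<epsilon> > 0\<close> in simp)
    qed
    show ?thesis
    proof (intro exI[of _ "\<lambda>F. finite F \<and> F0 \<subseteq> F \<and> F \<subseteq> B"] conjI allI impI)
      show "\<forall>\<^sub>F F in finite_subsets_at_top B. finite F \<and> F0 \<subseteq> F \<and> F \<subseteq> B"
        using F0 unfolding eventually_finite_subsets_at_top by (intro exI[of _ F0]) auto
    next
      fix F F' assume "(finite F \<and> F0 \<subseteq> F \<and> F \<subseteq> B) \<and> finite F' \<and> F0 \<subseteq> F' \<and> F' \<subseteq> B"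
      then show "dist (\<Sum>e\<in>F. a e *\<^sub>C e) (\<Sum>e\<in>F'. a e *\<^sub>C e) < \<epsilon>"
        using dist_triangle_half_l[OF near[of F] near[of F']] by simp
    qed
  qed
  then have "cauchy_filter (filtermap (sum (\<lambda>e. a e *\<^sub>C e)) (finite_subsets_at_top B))"
    by (simp add: cauchy_filter_metric_filtermap)
  moreover have "complete (UNIV :: 'a set)"
    by (meson Cauchy_convergent UNIV_I complete_def convergent_def)
  ultimately obtain L where "(sum (\<lambda>e. a e *\<^sub>C e) \<longlongrightarrow> L) (finite_subsets_at_top B)"
    using complete_uniform[where S=UNIV] by (force simp add: filterlim_def)
  then show ?thesis
    using summable_on_def has_sum_def by blast
qed

lemma cinner_infsum_orthonormal:
  assumes B: "orthonormal B" and a: "(\<lambda>e. a e *\<^sub>C e) summable_on B" and "e \<in> B"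
  shows "cinner e (\<Sum>\<^sub>\<infinity>e'\<in>B. a e' *\<^sub>C e') = a e"
proof -
  have "((\<lambda>e'. cinner e (a e' *\<^sub>C e')) has_sum cinner e (\<Sum>\<^sub>\<infinity>e'\<in>B. a e' *\<^sub>C e')) B"
    by (rule has_sum_bounded_linear[OF bounded_linear_cinner has_sum_infsum[OF a]])
  moreover have "((\<lambda>e'. cinner e (a e' *\<^sub>C e')) has_sum a e) B"
    by (rule has_sum_finite_neutralI[of "{e}"])
       (use assms in \<open>auto simp: cinner_scaleC_right cinner_orthonormal\<close>)
  ultimately show ?thesis
    using has_sum_unique by blast
qed

lemma onb_expansion:
  assumes "is_onb B"
  shows "((\<lambda>e. cinner e x *\<^sub>C e) has_sum x) B"
proof -
  have B: "orthonormal B"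
    using assms by (simp add: is_onb_iff)
  have s: "(\<lambda>e. cinner e x *\<^sub>C e) summable_on B"
    by (intro orthonormal_summable bessel_summable B)
  have "cinner e (x - (\<Sum>\<^sub>\<infinity>e\<in>B. cinner e x *\<^sub>C e)) = 0" if "e \<in> B" for e
    using cinner_infsum_orthonormal[OF B s that] by (simp add: cinner_diff_right)
  then have "x - (\<Sum>\<^sub>\<infinity>e\<in>B. cinner e x *\<^sub>C e) = 0"
    using assms unfolding is_onb_iff by blast
  then show ?thesis
    using has_sum_infsum[OF s] by simp
qed

lemma onb_parseval_cinner:
  assumes "is_onb B"
  shows "((\<lambda>e. cinner e x * cinner y e) has_sum cinner y x) B"
  using has_sum_bounded_linear[OF bounded_linear_cinner[of y] onb_expansion[OF assms, of x]]
  by (simp add: cinner_scaleC_right)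

lemma onb_parseval:
  assumes "is_onb B"
  shows "((\<lambda>e. (cmod (cinner e x))\<^sup>2) has_sum (norm x)\<^sup>2) B"
proof -
  have "cinner e x * cinner x e = complex_of_real ((cmod (cinner e x))\<^sup>2)" for e
    by (metis cinner_commute complex_norm_square)
  then have "((\<lambda>e. complex_of_real ((cmod (cinner e x))\<^sup>2)) has_sum complex_of_real ((norm x)\<^sup>2)) B"
    using onb_parseval_cinner[OF assms, of x x] by (simp add: cinner_self)
  then show ?thesis
    using has_sum_of_real_iff by blast
qed

text \<open>Supplies the uniqueness half of the descriptions that define \<open>op_fun\<close> and
  \<open>abs_op\<close>.\<close>

lemma bounded_linear_eq_on_onb:
  assumes "is_onb B" "bounded_clinear S" "bounded_clinear T" "\<And>e. e \<in> B \<Longrightarrow> S e = T e"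
  shows "S = T"
proof
  fix x
  have "((\<lambda>e. S (cinner e x *\<^sub>C e)) has_sum S x) B"
    using bounded_linear_if_bounded_clinear[OF assms(2)] onb_expansion[OF assms(1)]
    by (rule has_sum_bounded_linear)
  then have "((\<lambda>e. T (cinner e x *\<^sub>C e)) has_sum S x) B"
    by (rule has_sum_cong[THEN iffD1, rotated])
       (simp add: assms(4) bounded_clinear_scaleC[OF assms(2)] bounded_clinear_scaleC[OF assms(3)])
  moreover have "((\<lambda>e. T (cinner e x *\<^sub>C e)) has_sum T x) B"
    using bounded_linear_if_bounded_clinear[OF assms(3)] onb_expansion[OF assms(1)]
    by (rule has_sum_bounded_linear)
  ultimately show "S x = T x"
    by (rule has_sum_unique)
qed

section \<open>Eigenbasis of an operator with compact inverse\<close>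

lemma onb_eqI:
  assumes "is_onb B" "\<And>e. e \<in> B \<Longrightarrow> cinner e x = cinner e y"
  shows "x = y"
proof -
  have "\<forall>e\<in>B. cinner e (x - y) = 0"
    using assms(2) by (simp add: cinner_diff_right)
  then have "x - y = 0"
    using assms(1) unfolding is_onb_iff by blast
  then show ?thesis
    by simp
qed

lemma cinner_eqI:
  assumes "\<And>y. cinner x y = cinner x' (y::'h::complex_hilbert_space)"
  shows "x = x'"
proof -
  have "cinner (x - x') (x - x') = 0"
    using assms by (simp add: cinner_diff_left)
  then show ?thesis
    by (simp add: cinner_self)
qed

lemma norm_diff_power2:
  "(norm (x - y))\<^sup>2 = (norm x)\<^sup>2 - 2 * Re (cinner x y) + (norm (y::'h::complex_hilbert_space))\<^sup>2"
proof -
  have "Re (cinner (x - y) (x - y)) = Re (cinner x x) - Re (cinner x y) - Re (cinner y x) + Re (cinner y y)"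
    by (simp add: cinner_diff_left cinner_diff_right)
  moreover have "Re (cinner y x) = Re (cinner x y)"
    by (subst cinner_commute) simp
  ultimately show ?thesis
    by (simp add: cinner_self)
qed

lemma cinner_scaleR_right: "cinner x (r *\<^sub>R y) = r * cinner x (y::'h::complex_hilbert_space)"
  by (simp add: scaleR_eq_scaleC cinner_scaleC_right)

lemma cinner_scaleR_left: "cinner (r *\<^sub>R x) y = r * cinner x (y::'h::complex_hilbert_space)"
  by (simp add: scaleR_eq_scaleC cinner_scaleC_left)

lemma csubspace_scaleR: "csubspace W \<Longrightarrow> x \<in> W \<Longrightarrow> r *\<^sub>R x \<in> W"
  by (simp add: csubspace_def scaleR_eq_scaleC)

lemma csubspace_add: "csubspace W \<Longrightarrow> x \<in> W \<Longrightarrow> y \<in> W \<Longrightarrow> x + y \<in> W"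
  by (simp add: csubspace_def)

text \<open>With \<open>M\<close> the supremum of \<open>\<parallel>S u\<parallel>\<close> over the unit ball of \<open>W\<close>, symmetry gives
  \<open>\<parallel>S\<^sup>2 u - M\<^sup>2 u\<parallel>\<^sup>2 \<le> M\<^sup>4 - M\<^sup>2 \<parallel>S u\<parallel>\<^sup>2\<close>, so a maximising sequence consists of approximate
  eigenvectors of \<open>S\<^sup>2\<close>, and compactness makes it converge.\<close>

lemma compact_symmetric_eigenvector:
  fixes S :: "'h::complex_hilbert_space \<Rightarrow> 'h"
  assumes S: "compact_op S" and sym: "\<And>x y. cinner (S x) y = cinner x (S y)"
    and W: "closed W" "csubspace W" "\<And>x. x \<in> W \<Longrightarrow> S x \<in> W"
    and x0: "x0 \<in> W" "S x0 \<noteq> 0"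
  obtains m v where "m \<noteq> 0" "v \<in> W" "norm v = 1" "S v = m *\<^sub>R v"
proof -
  have lin: "bounded_linear S"
    using S by (simp add: compact_op_def bounded_clinear_def)
  interpret S: bounded_linear S
    by (rule lin)
  define U where "U = W \<inter> cball 0 1"
  define M where "M = (SUP u\<in>U. norm (S u))"
  obtain K where K: "\<And>x. norm (S x) \<le> norm x * K" "K \<ge> 0"
    using S.nonneg_bounded by blast
  have bdd: "bdd_above ((\<lambda>u. norm (S u)) ` U)"
  proof (rule bdd_aboveI2)
    fix u assume "u \<in> U"
    then show "norm (S u) \<le> 1 * K"
      using K(1)[of u] mult_right_mono[of "norm u" 1 K] K(2) by (simp add: U_def)
  qed
  have le_M: "norm (S z) \<le> M * norm z" if "z \<in> W" for z
  proof (cases "z = 0")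
    case True
    then show ?thesis by (simp add: S.zero)
  next
    case False
    have "inverse (norm z) *\<^sub>R z \<in> U"
      using that W(2) False by (simp add: U_def csubspace_scaleR)
    then have "norm (S (inverse (norm z) *\<^sub>R z)) \<le> M"
      unfolding M_def by (intro cSUP_upper bdd)
    then show ?thesis
      using False by (simp add: S.scaleR field_simps)
  qed
  have M: "M > 0"
    using le_M[OF x0(1)] x0(2) by (smt (verit) norm_ge_zero mult_nonpos_nonneg zero_less_norm_iff)
  have "\<exists>u\<in>U. M - inverse (real (Suc n)) < norm (S u)" for n
  proof -
    have "U \<noteq> {}"
      using W(2) by (auto simp: U_def csubspace_def)
    then show ?thesis
      unfolding M_def by (subst less_cSUP_iff[symmetric]) (use bdd in auto)
  qed
  then obtain u where u: "\<And>n. u n \<in> U" "\<And>n. M - inverse (real (Suc n)) < norm (S (u n))"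
    by metis
  have comp: "compact (closure (S ` cball 0 1))"
    using S by (simp add: compact_op_def)
  have "\<forall>n. S (u n) \<in> closure (S ` cball 0 1)"
    using u(1) closure_subset[of "S ` cball 0 1"] by (auto simp: U_def)
  then obtain y r where r: "strict_mono r" and y: "((\<lambda>n. S (u n)) \<circ> r) \<longlonglongrightarrow> y"
    using comp unfolding compact_def by metis
  define v where "v n = u (r n)" for n
  have vU: "v n \<in> U" and vW: "v n \<in> W" for n
    using u(1) by (auto simp: v_def U_def)
  have Sv: "(\<lambda>n. S (v n)) \<longlonglongrightarrow> y"
    using y by (simp add: v_def comp_def)
  have Sv_le: "\<forall>n. norm (S (v n)) \<le> M"
    unfolding M_def by (intro allI cSUP_upper bdd vU)
  have Sv_ge: "\<forall>n. M - inverse (real (Suc n)) \<le> norm (S (v n))"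
  proof
    fix n
    have "inverse (real (Suc (r n))) \<le> inverse (real (Suc n))"
      using seq_suble[OF r, of n] by (intro le_imp_inverse_le) auto
    then show "M - inverse (real (Suc n)) \<le> norm (S (v n))"
      using u(2)[of "r n"] unfolding v_def by linarith
  qed
  have "(\<lambda>n. M - inverse (real (Suc n))) \<longlonglongrightarrow> M"
    using tendsto_diff[OF tendsto_const LIMSEQ_inverse_real_of_nat, of M] by simp
  then have nSv: "(\<lambda>n. norm (S (v n))) \<longlonglongrightarrow> M"
    by (rule tendsto_sandwich[OF always_eventually[OF Sv_ge] always_eventually[OF Sv_le] _ tendsto_const])
  define d where "d n = S (S (v n)) - M\<^sup>2 *\<^sub>R v n" for n
  have d_le: "\<forall>n. (norm (d n))\<^sup>2 \<le> M ^ 4 - M\<^sup>2 * (norm (S (v n)))\<^sup>2"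
  proof
    fix n
    have "Re (cinner (S (S (v n))) (M\<^sup>2 *\<^sub>R v n)) = M\<^sup>2 * (norm (S (v n)))\<^sup>2"
      unfolding cinner_scaleR_right sym[of "S (v n)"] cinner_self by simp
    then have "(norm (d n))\<^sup>2 = (norm (S (S (v n))))\<^sup>2 - 2 * (M\<^sup>2 * (norm (S (v n)))\<^sup>2) + (M\<^sup>2 * norm (v n))\<^sup>2"
      unfolding d_def norm_diff_power2 by simp
    moreover have "(norm (S (S (v n))))\<^sup>2 \<le> (M * norm (S (v n)))\<^sup>2"
      using le_M[OF W(3)[OF vW]] by (intro power_mono) auto
    moreover have "(M\<^sup>2 * norm (v n))\<^sup>2 \<le> (M\<^sup>2 * 1)\<^sup>2"
      using vU[of n] by (intro power_mono mult_left_mono) (auto simp: U_def)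
    moreover have "(M\<^sup>2)\<^sup>2 = M ^ 4"
      by simp
    ultimately show "(norm (d n))\<^sup>2 \<le> M ^ 4 - M\<^sup>2 * (norm (S (v n)))\<^sup>2"
      by (simp add: power_mult_distrib)
  qed
  have "(\<lambda>n. M ^ 4 - M\<^sup>2 * (norm (S (v n)))\<^sup>2) \<longlonglongrightarrow> M ^ 4 - M\<^sup>2 * M\<^sup>2"
    by (intro tendsto_intros nSv)
  moreover have "M ^ 4 - M\<^sup>2 * M\<^sup>2 = 0"
    by (simp add: power4_eq_xxxx power2_eq_square)
  ultimately have "(\<lambda>n. M ^ 4 - M\<^sup>2 * (norm (S (v n)))\<^sup>2) \<longlonglongrightarrow> 0"
    by simp
  then have "(\<lambda>n. (norm (d n))\<^sup>2) \<longlonglongrightarrow> 0"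
    by (rule tendsto_sandwich[OF _ always_eventually[OF d_le] tendsto_const, rotated]) simp
  then have "(\<lambda>n. sqrt ((norm (d n))\<^sup>2)) \<longlonglongrightarrow> sqrt 0"
    by (intro tendsto_intros)
  then have d0: "d \<longlonglongrightarrow> 0"
    by (simp add: tendsto_norm_zero_iff)
  have SSv: "(\<lambda>n. S (S (v n))) \<longlonglongrightarrow> S y"
    by (rule S.tendsto[OF Sv])
  \<comment> \<open>Compactness only makes \<open>S (v n)\<close> converge. Since
    \<open>M\<^sup>2 *\<^sub>R v n = S (S (v n)) - d n\<close> with \<open>d\<close> tending to 0,
    the vectors \<open>v n\<close> converge as well.\<close>
  define x where "x = inverse (M\<^sup>2) *\<^sub>R S y"
  have "(\<lambda>n. inverse (M\<^sup>2) *\<^sub>R (S (S (v n)) - d n)) \<longlonglongrightarrow> inverse (M\<^sup>2) *\<^sub>R (S y - 0)"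
    by (intro tendsto_intros SSv d0)
  then have vx: "v \<longlonglongrightarrow> x"
    using M by (simp add: d_def x_def)
  have xW: "x \<in> W"
    using W(1) vW vx closed_sequentially by blast
  have "y = S x"
    using LIMSEQ_unique[OF Sv S.tendsto[OF vx]] .
  then have SSx: "S (S x) = M\<^sup>2 *\<^sub>R x"
    using M by (simp add: x_def)
  have "norm (S x) = M"
    using LIMSEQ_unique[OF nSv tendsto_norm[OF Sv]] \<open>y = S x\<close> by simp
  then have "x \<noteq> 0"
    using M S.zero by auto
  \<comment> \<open>Factor (S - M)(S + M) x = 0: either (S + M) x vanishes and \<open>x\<close>
    belongs to the eigenvalue -M, or (S + M) x is itself an eigenvector for M.\<close>
  have "\<exists>m w. m \<noteq> 0 \<and> w \<in> W \<and> w \<noteq> 0 \<and> S w = m *\<^sub>R w"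
  proof (cases "S x + M *\<^sub>R x = 0")
    case True
    then have "S x = (- M) *\<^sub>R x"
      by (simp add: add_eq_0_iff2)
    then show ?thesis
      using M xW \<open>x \<noteq> 0\<close> by (intro exI[of _ "- M"] exI[of _ x]) simp
  next
    case False
    have "S (S x + M *\<^sub>R x) = M *\<^sub>R (S x + M *\<^sub>R x)"
      by (simp add: S.add S.scaleR SSx scaleR_add_right power2_eq_square add.commute)
    then show ?thesis
      using M False csubspace_add[OF W(2) W(3)[OF xW] csubspace_scaleR[OF W(2) xW]]
      by (intro exI[of _ M] exI[of _ "S x + M *\<^sub>R x"]) simp
  qed
  then obtain m w where mw: "m \<noteq> 0" "w \<in> W" "w \<noteq> 0" "S w = m *\<^sub>R w"
    by blast
  show ?thesis
  proof (rule that[OF mw(1)])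
    show "inverse (norm w) *\<^sub>R w \<in> W"
      using W(2) mw(2) by (rule csubspace_scaleR)
    show "norm (inverse (norm w) *\<^sub>R w) = 1"
      using mw(3) by simp
    show "S (inverse (norm w) *\<^sub>R w) = m *\<^sub>R inverse (norm w) *\<^sub>R w"
      by (simp add: S.scaleR mw(4))
  qed
qed

text \<open>All that the trace computations need to know about D. Symmetry forces eigenvectors of
  different eigenvalues to be orthogonal, and the gap keeps negative powers of |D| bounded.\<close>

locale eigenbasis =
  fixes V :: "'h::complex_hilbert_space set" and D :: "'h \<Rightarrow> 'h"
    and E :: "'h set" and l :: "'h \<Rightarrow> real" and m :: real
  assumes onb: "is_onb E" and subset: "E \<subseteq> V"
    and symmetric: "\<And>x y. x \<in> V \<Longrightarrow> y \<in> V \<Longrightarrow> cinner (D x) y = cinner x (D y)"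
    and eigenvalue: "\<And>e. e \<in> E \<Longrightarrow> D e = l e *\<^sub>R e"
    and gap: "m > 0" "\<And>e. e \<in> E \<Longrightarrow> m \<le> \<bar>l e\<bar>"

text \<open>Zorn's lemma gives a maximal orthonormal set of eigenvectors. Its orthogonal complement
  is invariant under the injective inverse \<open>S\<close>, so if it were nonzero,
  \<open>compact_symmetric_eigenvector\<close> would find another eigenvector in it. The gap is the
  reciprocal of a bound \<open>K\<close> for \<open>S\<close>.\<close>

lemma eigenbasis_exists:
  fixes V :: "'h::complex_hilbert_space set"
  assumes sa: "self_adjoint V D" and ci: "compact_inverse V D"
  obtains E l m where "eigenbasis V D E l m"
proof -
  define S where "S = inv_into V D"
  have bij: "bij_betw D V UNIV"
    using ci by (simp add: compact_inverse_def)
  have SV: "S x \<in> V" and DS: "D (S x) = x" for x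
    using bij by (auto simp: S_def bij_betw_def intro!: inv_into_into f_inv_into_f)
  have SD: "S (D x) = x" if "x \<in> V" for x
    using bij that by (simp add: S_def bij_betw_def)
  have comp: "compact_op S"
    using ci by (simp add: compact_inverse_def S_def)
  interpret S: bounded_linear S
    using comp by (simp add: compact_op_def bounded_clinear_def)
  have V: "csubspace V" and lin: "clinear_on V D"
    using sa by (auto simp: self_adjoint_def)
  have D_scaleR: "D (r *\<^sub>R x) = r *\<^sub>R D x" if "x \<in> V" for r x
    using lin that by (simp add: clinear_on_def scaleR_eq_scaleC)
  have symD: "cinner (D x) y = cinner x (D y)" if "x \<in> V" "y \<in> V" for x y
  proof -
    have "(x, D x) \<in> adjoint_graph V D"
      using sa that by (auto simp: self_adjoint_def op_graph_def)
    then show ?thesis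
      using that by (simp add: adjoint_graph_def)
  qed
  have symS: "cinner (S x) y = cinner x (S y)" for x y
    using symD[OF SV[of x] SV[of y]] by (simp add: DS)
  define Eig where "Eig = {e \<in> V. \<exists>r::real. D e = r *\<^sub>R e}"
  define \<F> where "\<F> = {E. orthonormal E \<and> E \<subseteq> Eig}"
  have "\<exists>M\<in>\<F>. \<forall>X\<in>\<F>. M \<subseteq> X \<longrightarrow> X = M"
  proof (rule subset_Zorn')
    fix C assume C: "subset.chain \<F> C"
    have X: "orthonormal X" "X \<subseteq> Eig" if "X \<in> C" for X
      using C that unfolding subset_chain_def \<F>_def by auto
    have "cinner e e' = 0" if e: "e \<in> \<Union>C" "e' \<in> \<Union>C" "e \<noteq> e'" for e e'
    proof -
      obtain X where "X \<in> C" "e \<in> X" "e' \<in> X"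
        using C e unfolding subset_chain_def by blast
      then show ?thesis
        using X(1) e(3) by (simp add: orthonormal_def)
    qed
    moreover have "norm e = 1" if "e \<in> \<Union>C" for e
      using X(1) that by (auto simp: orthonormal_def)
    ultimately have "orthonormal (\<Union>C)"
      unfolding orthonormal_def by blast
    moreover have "\<Union>C \<subseteq> Eig"
      using X(2) by blast
    ultimately show "\<Union>C \<in> \<F>"
      by (simp add: \<F>_def)
  qed
  then obtain E where "E \<in> \<F>" and max: "\<forall>X\<in>\<F>. E \<subseteq> X \<longrightarrow> X = E"
    by (rule bexE)
  then have E: "orthonormal E" "E \<subseteq> Eig"
    by (simp_all add: \<F>_def)
  have "x = 0" if x: "\<forall>e\<in>E. cinner e x = 0" for x
  proof (rule ccontr)
    assume "x \<noteq> 0"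
    define W where "W = {x. \<forall>e\<in>E. cinner e x = 0}"
    have "W = (\<Inter>e\<in>E. cinner e -` {0})"
      by (auto simp: W_def)
    moreover have "closed (cinner e -` {0})" for e :: 'h
      by (intro closed_vimage linear_continuous_on bounded_linear_cinner) auto
    ultimately have "closed W"
      by auto
    moreover have "csubspace W"
      by (auto simp: csubspace_def W_def cinner_add_right cinner_scaleC_right)
    moreover have "S w \<in> W" if "w \<in> W" for w
      unfolding W_def
    proof (intro CollectI ballI)
      fix e assume "e \<in> E"
      then obtain r where r: "e \<in> V" "D e = r *\<^sub>R e"
        using E(2) by (auto simp: Eig_def)
      \<comment> \<open>The eigenvalue equation is rewritten for the inverse. It also shows that
        \<open>r\<close> is nonzero, which lets orthogonality to \<open>e\<close> pass from
        \<open>w\<close> to \<open>S w\<close>.\<close>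
      have er: "e = r *\<^sub>R S e"
        using SD[OF r(1)] r(2) by (simp add: S.scaleR)
      have "cinner e w = r * cinner (S e) w"
        using arg_cong[OF er, of "\<lambda>z. cinner z w"] unfolding cinner_scaleR_left .
      moreover have "r \<noteq> 0"
      proof
        assume "r = 0"
        have "e = 0"
          using er unfolding \<open>r = 0\<close> by (simp only: scaleR_zero_left)
        then show False
          using cinner_orthonormal[OF E(1) \<open>e \<in> E\<close> \<open>e \<in> E\<close>] by simp
      qed
      ultimately show "cinner e (S w) = 0"
        using that \<open>e \<in> E\<close> unfolding W_def symS[symmetric] by simp
    qed
    moreover have "x \<in> W"
      using x by (simp add: W_def)
    moreover have "S x \<noteq> 0"
    proof
      assume "S x = 0"
      have "x = D 0"
        using DS[of x] \<open>S x = 0\<close> by simp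
      also have "\<dots> = 0"
        using D_scaleR[of "S x" 0] SV by simp
      finally show False
        using \<open>x \<noteq> 0\<close> by simp
    qed
    ultimately obtain k v where kv: "k \<noteq> 0" "v \<in> W" "norm v = 1" "S v = k *\<^sub>R v"
      using compact_symmetric_eigenvector[OF comp symS] by metis
    have "inverse k *\<^sub>R S v \<in> V"
      by (rule csubspace_scaleR[OF V SV])
    then have "v \<in> V"
      using kv(1,4) by simp
    have "v = k *\<^sub>R D v"
      using DS[of v] D_scaleR[OF \<open>v \<in> V\<close>] kv(4) by simp
    then have "inverse k *\<^sub>R v = inverse k *\<^sub>R (k *\<^sub>R D v)"
      by (rule arg_cong)
    then have "D v = inverse k *\<^sub>R v"
      using kv(1) by simp
    then have "insert v E \<subseteq> Eig"
      using E(2) \<open>v \<in> V\<close> by (auto simp: Eig_def)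
    moreover have "cinner e v = 0" "cinner v e = 0" if "e \<in> E" for e
      using kv(2) that cinner_commute[of v e] by (simp_all add: W_def)
    then have "orthonormal (insert v E)"
      using E(1) kv(3) unfolding orthonormal_def by blast
    ultimately have "v \<in> E"
      using max unfolding \<F>_def by blast
    then have "cinner v v = 0"
      using kv(2) by (simp add: W_def)
    then show False
      using kv(3) by (simp add: cinner_self)
  qed
  then have onb: "is_onb E"
    using E(1) by (simp add: is_onb_iff)
  define l where "l e = (SOME r::real. D e = r *\<^sub>R e)" for e
  have l: "D e = l e *\<^sub>R e" if "e \<in> E" for e
  proof -
    have "\<exists>r::real. D e = r *\<^sub>R e"
      using E(2) that unfolding Eig_def by blast
    then show ?thesis
      unfolding l_def by (rule someI_ex)
  qed
  obtain K where K: "K > 0" "\<And>x. norm (S x) \<le> norm x * K"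
    using S.pos_bounded by blast
  have "inverse K \<le> \<bar>l e\<bar>" if "e \<in> E" for e
  proof -
    have "e \<in> V"
      using that E(2) unfolding Eig_def by blast
    have "norm e = 1"
      using that E(1) unfolding orthonormal_def by blast
    have "norm e \<le> norm (D e) * K"
      using K(2)[of "D e"] unfolding SD[OF \<open>e \<in> V\<close>] .
    then have "1 \<le> \<bar>l e\<bar> * K"
      unfolding l[OF that] norm_scaleR \<open>norm e = 1\<close> by simp
    then show ?thesis
      using K(1) by (simp add: field_simps)
  qed
  moreover have "E \<subseteq> V"
    using E(2) unfolding Eig_def by blast
  ultimately have "eigenbasis V D E l (inverse K)"
    using onb symD l K(1) by (simp add: eigenbasis_def)
  then show ?thesis
    by (rule that)
qed

section \<open>Functional calculus and traces in an eigenbasis\<close>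

lemma adjoint_op_symmetric:
  assumes T: "bounded_clinear T" and sym: "\<And>x y. cinner (T x) y = cinner x (T y)"
  shows "adjoint_op T = T"
  unfolding adjoint_op_def
proof (rule the_equality)
  show "bounded_clinear T \<and> (\<forall>x y. cinner (T x) y = cinner x (T y))"
    using T sym by blast
next
  fix S assume S: "bounded_clinear S \<and> (\<forall>x y. cinner (S x) y = cinner x (T y))"
  show "S = T"
  proof
    fix x
    have "cinner (S x) y = cinner (T x) y" for y
      using S sym[of x y] by simp
    then show "S x = T x"
      by (rule cinner_eqI)
  qed
qed

text \<open>This is Bessel's inequality for the adjoint of \<open>A\<close> applied to
  \<open>e\<close>, obtained without constructing the adjoint: test \<open>A\<close> on the vector
  \<open>y\<close> whose coefficients are the conjugates of \<open>cinner e (A b)\<close>; then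
  \<open>cinner e (A y)\<close> is the squared norm of \<open>y\<close> and is at most
  \<open>norm y * K\<close>.\<close>

lemma bessel_bounded_op:
  assumes "orthonormal F" "finite F" "bounded_clinear A" "\<And>x. norm (A x) \<le> norm x * K" "norm e = 1"
  shows "(\<Sum>b\<in>F. (cmod (cinner e (A b)))\<^sup>2) \<le> K\<^sup>2"
proof -
  interpret A: bounded_linear A
    using assms(3) by (rule bounded_linear_if_bounded_clinear)
  define y where "y = (\<Sum>b\<in>F. cnj (cinner e (A b)) *\<^sub>C b)"
  have ny: "(norm y)\<^sup>2 = (\<Sum>b\<in>F. (cmod (cinner e (A b)))\<^sup>2)"
    unfolding y_def norm_orthonormal_sum[OF assms(1,2)] by simp
  have "cinner e (A y) = (\<Sum>b\<in>F. cnj (cinner e (A b)) * cinner e (A b))"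
    unfolding y_def A.sum cinner_sum_right
    by (simp add: bounded_clinear_scaleC[OF assms(3)] cinner_scaleC_right)
  also have "\<dots> = complex_of_real ((norm y)\<^sup>2)"
    unfolding cnj_mult_self ny by simp
  finally have "(norm y)\<^sup>2 \<le> norm e * norm (A y)"
    using cauchy_schwarz[of e "A y"] by (simp add: norm_power)
  also have "\<dots> \<le> norm y * K"
    using assms(4,5) by simp
  finally have "norm y * norm y \<le> norm y * K"
    by (simp add: power2_eq_square)
  then have "norm y \<le> \<bar>K\<bar>"
    by (cases "norm y = 0") (auto simp: mult_le_cancel_left)
  then have "(norm y)\<^sup>2 \<le> \<bar>K\<bar>\<^sup>2"
    by (intro power_mono) auto
  then show ?thesis
    by (simp add: ny)
qed

context eigenbasis
begin

lemma orthonormal_E: "orthonormal E"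
  using onb by (simp add: is_onb_iff)

lemma norm_E: "e \<in> E \<Longrightarrow> norm e = 1"
  using onb by (simp add: is_onb_def)

text \<open>The diagonal series converges by Riesz-Fischer and is bounded by Parseval. It satisfies
  the description of \<open>op_fun\<close>, and any other candidate agrees with it on the
  basis.\<close>

lemma op_fun_characterisation:
  assumes g: "\<And>e. e \<in> E \<Longrightarrow> \<bar>g (l e)\<bar> \<le> K"
  shows "bounded_clinear (op_fun V D g) \<and>
    (\<forall>e\<in>E. op_fun V D g e = g (l e) *\<^sub>R e) \<and>
    (\<forall>e\<in>E. \<forall>x. cinner e (op_fun V D g x) = g (l e) * cinner e x)"
proof -
  define T where "T x = (\<Sum>\<^sub>\<infinity>e\<in>E. (g (l e) * cinner e x) *\<^sub>C e)" for x
  have coeff_le: "(cmod (g (l e) * cinner e x))\<^sup>2 \<le> K\<^sup>2 * (cmod (cinner e x))\<^sup>2" if "e \<in> E" for e x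
    unfolding norm_mult power_mult_distrib norm_of_real
    using power_mono[OF g[OF that] abs_ge_zero, of 2] by (intro mult_right_mono) auto
  have "(\<lambda>e. (cmod (g (l e) * cinner e x))\<^sup>2) summable_on E" for x
    by (rule summable_on_comparison_test[OF summable_on_cmult_right[OF bessel_summable[OF orthonormal_E]]])
       (auto intro: coeff_le)
  then have T_coeff: "cinner e (T x) = g (l e) * cinner e x" if "e \<in> E" for e x
    unfolding T_def by (intro cinner_infsum_orthonormal orthonormal_summable orthonormal_E that)
  have T_norm: "norm (T x) \<le> norm x * \<bar>K\<bar>" for x
  proof -
    have "((\<lambda>e. K\<^sup>2 * (cmod (cinner e x))\<^sup>2) has_sum K\<^sup>2 * (norm x)\<^sup>2) E"
      by (rule has_sum_cmult_right[OF onb_parseval[OF onb]])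
    then have "(norm (T x))\<^sup>2 \<le> K\<^sup>2 * (norm x)\<^sup>2"
      by (rule has_sum_mono[OF onb_parseval[OF onb]]) (simp only: T_coeff coeff_le)
    also have "\<dots> = (norm x * \<bar>K\<bar>)\<^sup>2"
      by (simp add: power_mult_distrib)
    finally show ?thesis
      by (rule power2_le_imp_le) simp
  qed
  have T_scaleC: "T (c *\<^sub>C x) = c *\<^sub>C T x" for c x
    by (rule onb_eqI[OF onb]) (simp add: T_coeff cinner_scaleC_right)
  have T_add: "T (x + y) = T x + T y" for x y
    by (rule onb_eqI[OF onb]) (simp add: T_coeff cinner_add_right distrib_left)
  have T_lin: "bounded_linear T"
    by (rule bounded_linear_intro[where K = "\<bar>K\<bar>"])
       (simp_all add: T_add T_norm scaleR_eq_scaleC T_scaleC)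
  have T: "bounded_clinear T"
    unfolding bounded_clinear_def using T_lin T_scaleC by blast
  \<comment> \<open>The description quantifies over all eigenvectors of D, not only those in
    \<open>E\<close>. By symmetry an eigenvector for \<open>r\<close> has nonzero coefficients only
    at those \<open>e\<close> with \<open>l e = r\<close>.\<close>
  have T_eig: "T x = g r *\<^sub>R x" if "x \<in> V" "D x = r *\<^sub>R x" for r x
  proof (rule onb_eqI[OF onb])
    fix e assume e: "e \<in> E"
    have "complex_of_real (l e) * cinner e x = r * cinner e x"
      using symmetric[of e x] that e subset eigenvalue[OF e]
      by (auto simp: cinner_scaleR_left cinner_scaleR_right)
    then have "cinner e x = 0 \<or> l e = r"
      by simp
    then show "cinner e (T x) = cinner e (g r *\<^sub>R x)"
      by (auto simp: T_coeff[OF e] cinner_scaleR_right)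
  qed
  have "op_fun V D g = T"
    unfolding op_fun_def
  proof (rule the_equality)
    show "bounded_clinear T \<and> (\<forall>l. \<forall>x\<in>V. D x = l *\<^sub>R x \<longrightarrow> T x = g l *\<^sub>R x)"
      using T T_eig by blast
  next
    fix S assume S: "bounded_clinear S \<and> (\<forall>l. \<forall>x\<in>V. D x = l *\<^sub>R x \<longrightarrow> S x = g l *\<^sub>R x)"
    have "S e = T e" if "e \<in> E" for e
    proof -
      have "e \<in> V" "D e = l e *\<^sub>R e"
        using that subset eigenvalue by auto
      then show ?thesis
        using S T_eig by metis
    qed
    then show "S = T"
      using bounded_linear_eq_on_onb[OF onb _ T] S by blast
  qed
  moreover have "T e = g (l e) *\<^sub>R e" if "e \<in> E" for e
    using T_eig that subset eigenvalue by blast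
  ultimately show ?thesis
    using T T_coeff by blast
qed

lemma op_fun_symmetric:
  assumes g: "\<And>e. e \<in> E \<Longrightarrow> \<bar>g (l e)\<bar> \<le> K"
  shows "cinner (op_fun V D g x) y = cinner x (op_fun V D g y)"
proof -
  let ?T = "op_fun V D g"
  have T: "cinner e (?T z) = g (l e) * cinner e z" if "e \<in> E" for e z
    using op_fun_characterisation[of g, OF g] that by blast
  have T': "cinner (?T z) e = g (l e) * cinner z e" if "e \<in> E" for e z
    using T[OF that, of z] cinner_commute[of "?T z" e] cinner_commute[of z e] by simp
  have "((\<lambda>e. cinner e y * cinner (?T x) e) has_sum cinner (?T x) y) E"
    by (rule onb_parseval_cinner[OF onb])
  then have "((\<lambda>e. cinner e (?T y) * cinner x e) has_sum cinner (?T x) y) E"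
    by (rule has_sum_cong[THEN iffD1, rotated]) (simp add: T T')
  moreover have "((\<lambda>e. cinner e (?T y) * cinner x e) has_sum cinner x (?T y)) E"
    by (rule onb_parseval_cinner[OF onb])
  ultimately show ?thesis
    by (rule has_sum_unique)
qed

lemma op_fun_quadratic_form:
  assumes g: "\<And>e. e \<in> E \<Longrightarrow> \<bar>g (l e)\<bar> \<le> K"
  shows "((\<lambda>e. g (l e) * (cmod (cinner e x))\<^sup>2) has_sum Re (cinner x (op_fun V D g x))) E"
    and "cinner x (op_fun V D g x) = complex_of_real (Re (cinner x (op_fun V D g x)))"
proof -
  let ?T = "op_fun V D g"
  have T: "cinner e (?T z) = g (l e) * cinner e z" if "e \<in> E" for e z
    using op_fun_characterisation[of g, OF g] that by blast
  have *: "cinner e (?T x) * cinner x e = complex_of_real (g (l e) * (cmod (cinner e x))\<^sup>2)"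
    if "e \<in> E" for e
  proof -
    have "cinner e (?T x) * cinner x e = g (l e) * (cnj (cinner e x) * cinner e x)"
      unfolding T[OF that] using cinner_commute[of x e] by simp
    then show ?thesis
      unfolding cnj_mult_self by simp
  qed
  have "((\<lambda>e. cinner e (?T x) * cinner x e) has_sum cinner x (?T x)) E"
    by (rule onb_parseval_cinner[OF onb])
  then have sum: "((\<lambda>e. complex_of_real (g (l e) * (cmod (cinner e x))\<^sup>2)) has_sum cinner x (?T x)) E"
    by (rule has_sum_cong[THEN iffD1, rotated]) (rule *)
  show "((\<lambda>e. g (l e) * (cmod (cinner e x))\<^sup>2) has_sum Re (cinner x (?T x))) E"
    using has_sum_Re[OF sum] by simp
  have "((\<lambda>e. 0) has_sum Im (cinner x (?T x))) E"
    using has_sum_Im[OF sum] by simp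
  then have "Im (cinner x (?T x)) = 0"
    using has_sum_unique[OF has_sum_0_simp] by metis
  then show "cinner x (?T x) = complex_of_real (Re (cinner x (?T x)))"
    by (simp add: complex_eq_iff)
qed

text \<open>Uniqueness of the positive root, one basis vector at a time: if \<open>P\<close> has the
  same square and \<open>k = g (l e)\<close>, then \<open>y = P e - k *\<^sub>R e\<close> satisfies
  P y = - k y, which contradicts positivity of \<open>P\<close> unless \<open>y\<close> is zero,
  because \<open>k\<close> is strictly positive.\<close>

lemma abs_op_op_fun:
  assumes g: "\<And>e. e \<in> E \<Longrightarrow> 0 < g (l e)" "\<And>e. e \<in> E \<Longrightarrow> g (l e) \<le> K"
  shows "abs_op (op_fun V D g) = op_fun V D g"
proof -
  let ?T = "op_fun V D g"
  have gK: "\<bar>g (l e)\<bar> \<le> K" if "e \<in> E" for e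
    using g that by fastforce
  have T: "bounded_clinear ?T" and T_eig: "\<And>e. e \<in> E \<Longrightarrow> ?T e = g (l e) *\<^sub>R e"
    using op_fun_characterisation[of g, OF gK] by blast+
  have adj: "adjoint_op ?T = ?T"
    by (rule adjoint_op_symmetric[OF T op_fun_symmetric[of g, OF gK]])
  show ?thesis
    unfolding abs_op_def adj
  proof (rule the_equality)
    have "cinner x (?T x) \<in> \<real>\<^sub>\<ge>\<^sub>0" for x
    proof -
      have "0 \<le> Re (cinner x (?T x))"
        by (rule has_sum_nonneg[OF op_fun_quadratic_form(1)[of g, OF gK]])
           (auto intro!: mult_nonneg_nonneg less_imp_le[OF g(1)])
      then show ?thesis
        using op_fun_quadratic_form(2)[of g, OF gK, of x] by (metis nonneg_Reals_of_real_iff)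
    qed
    then show "positive_op ?T \<and> ?T \<circ> ?T = ?T \<circ> ?T"
      using T by (simp add: positive_op_def)
  next
    fix P assume P: "positive_op P \<and> P \<circ> P = ?T \<circ> ?T"
    have lin: "bounded_clinear P"
      using P by (simp add: positive_op_def)
    interpret P: bounded_linear P
      using lin by (rule bounded_linear_if_bounded_clinear)
    interpret T: bounded_linear ?T
      using T by (rule bounded_linear_if_bounded_clinear)
    have "P e = ?T e" if e: "e \<in> E" for e
    proof -
      define k where "k = g (l e)"
      define y where "y = P e - k *\<^sub>R e"
      have "P (P e) = ?T (?T e)"
        using P by (metis comp_apply)
      also have "\<dots> = k *\<^sub>R k *\<^sub>R e"
        by (simp add: T_eig[OF e] T.scaleR k_def)
      finally have "P y = - k *\<^sub>R y"
        by (simp add: y_def P.diff P.scaleR scaleR_diff_right)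
      then have "cinner y (P y) = complex_of_real (- k * (norm y)\<^sup>2)"
        by (simp add: cinner_scaleR_right cinner_self cinner_minus_right)
      moreover have "cinner y (P y) \<in> \<real>\<^sub>\<ge>\<^sub>0"
        using P by (simp add: positive_op_def)
      ultimately have "0 \<le> - k * (norm y)\<^sup>2"
        by (simp only: nonneg_Reals_of_real_iff)
      moreover have "k > 0"
        using g e by (simp add: k_def)
      ultimately have "norm y = 0"
        by (smt (verit) mult_pos_pos mult_minus_left norm_ge_zero zero_less_power2)
      then show ?thesis
        by (simp add: y_def T_eig[OF e] k_def)
    qed
    then show "P = ?T"
      by (rule bounded_linear_eq_on_onb[OF onb lin T])
  qed
qed

text \<open>The nontrivial direction starts from an unknown basis \<open>B\<close> with finite
  trace. A finite sum of values \<open>g (l e)\<close> is spread over \<open>B\<close> by Parseval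
  for the unit vectors \<open>e\<close>, and then bounded for each \<open>b\<close> by the quadratic
  form at \<open>b\<close>, so the trace over \<open>B\<close> bounds all finite sums over
  \<open>E\<close>.\<close>

lemma trace_class_op_fun_iff:
  assumes g: "\<And>e. e \<in> E \<Longrightarrow> 0 < g (l e)" "\<And>e. e \<in> E \<Longrightarrow> g (l e) \<le> K"
  shows "trace_class (op_fun V D g) \<longleftrightarrow> (\<lambda>e. g (l e)) summable_on E"
proof -
  let ?T = "op_fun V D g"
  have gK: "\<bar>g (l e)\<bar> \<le> K" if "e \<in> E" for e
    using g that by fastforce
  have T: "bounded_clinear ?T" and T_coeff: "\<And>e x. e \<in> E \<Longrightarrow> cinner e (?T x) = g (l e) * cinner e x"
    using op_fun_characterisation[of g, OF gK] by blast+
  have abs: "abs_op ?T = ?T"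
    using g by (rule abs_op_op_fun)
  show ?thesis
  proof
    assume "(\<lambda>e. g (l e)) summable_on E"
    then have "(\<lambda>e. complex_of_real (g (l e))) summable_on E"
      by (rule summable_on_of_real)
    then have "(\<lambda>e. cinner e (?T e)) summable_on E"
      by (rule summable_on_cong[THEN iffD1, rotated]) (simp add: T_coeff cinner_self norm_E)
    then show "trace_class ?T"
      unfolding trace_class_def abs using T onb by blast
  next
    assume "trace_class ?T"
    then obtain B where B: "is_onb B" and sum: "(\<lambda>b. cinner b (?T b)) summable_on B"
      unfolding trace_class_def abs by blast
    define q where "q b = Re (cinner b (?T b))" for b
    have q: "q summable_on B"
      unfolding q_def by (rule summable_on_Re[OF sum])
    show "(\<lambda>e. g (l e)) summable_on E"
    proof (rule nonneg_bdd_above_summable_on)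
      show "bdd_above (sum (\<lambda>e. g (l e)) ` {F. F \<subseteq> E \<and> finite F})"
      proof (rule bdd_aboveI2)
        fix F assume "F \<in> {F. F \<subseteq> E \<and> finite F}"
        then have F: "F \<subseteq> E" "finite F"
          by auto
        have "((\<lambda>b. \<Sum>e\<in>F. g (l e) * (cmod (cinner b e))\<^sup>2) has_sum (\<Sum>e\<in>F. g (l e) * (norm e)\<^sup>2)) B"
          using F(2) by (induction F) (auto intro!: has_sum_add has_sum_cmult_right onb_parseval[OF B])
        moreover have "(\<Sum>e\<in>F. g (l e) * (norm e)\<^sup>2) = (\<Sum>e\<in>F. g (l e))"
          by (intro sum.cong) (use F norm_E in auto)
        ultimately have "((\<lambda>b. \<Sum>e\<in>F. g (l e) * (cmod (cinner b e))\<^sup>2) has_sum (\<Sum>e\<in>F. g (l e))) B"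
          by simp
        then show "(\<Sum>e\<in>F. g (l e)) \<le> infsum q B"
        proof (rule has_sum_mono[OF _ has_sum_infsum[OF q]])
          fix b assume "b \<in> B"
          have "(\<Sum>e\<in>F. g (l e) * (cmod (cinner b e))\<^sup>2) = (\<Sum>e\<in>F. g (l e) * (cmod (cinner e b))\<^sup>2)"
            by (intro sum.cong) (auto simp: cinner_commute[of b] complex_mod_cnj)
          also have "\<dots> \<le> q b"
            unfolding q_def
            by (rule finite_sum_le_has_sum[OF op_fun_quadratic_form(1)[of g, OF gK] F(2,1)])
               (auto intro!: mult_nonneg_nonneg less_imp_le[OF g(1)])
          finally show "(\<Sum>e\<in>F. g (l e) * (cmod (cinner b e))\<^sup>2) \<le> q b" .
        qed
      qed
    qed (use g in \<open>auto intro: less_imp_le\<close>)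
  qed
qed

text \<open>Expanding in both bases gives the double series \<open>F e b\<close>: its sum over
  \<open>b\<close> is the diagonal term at \<open>e\<close>, its sum over \<open>e\<close> the
  diagonal term at \<open>b\<close>. The exchange is legitimate since a product is at most the sum
  of the squares, and Bessel bounds the two sums of squares by \<open>C\<^sup>2\<close> and 1,
  leaving the summable weight \<open>g (l e)\<close>.\<close>

lemma infsum_trace_op_fun:
  assumes g: "\<And>e. e \<in> E \<Longrightarrow> 0 \<le> g (l e)" "\<And>e. e \<in> E \<Longrightarrow> g (l e) \<le> K"
    and sum: "(\<lambda>e. g (l e)) summable_on E" and A: "bounded_clinear A" and B: "is_onb B"
  shows "(\<Sum>\<^sub>\<infinity>b\<in>B. cinner b (op_fun V D g (A b))) = (\<Sum>\<^sub>\<infinity>e\<in>E. g (l e) * cinner e (A e))"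
proof -
  let ?T = "op_fun V D g"
  have gK: "\<bar>g (l e)\<bar> \<le> K" if "e \<in> E" for e
    using g that by fastforce
  have T_coeff: "cinner e (?T x) = g (l e) * cinner e x" if "e \<in> E" for e x
    using op_fun_characterisation[of g, OF gK] that by blast
  have B': "orthonormal B"
    using B by (simp add: is_onb_iff)
  obtain C where C: "\<And>x. norm (A x) \<le> norm x * C"
    using bounded_linear.bounded[OF bounded_linear_if_bounded_clinear[OF A]] by blast
  define F where "F e b = g (l e) * cinner e (A b) * cinner b e" for e b
  have F_le: "cmod (F e b) \<le> g (l e) * ((cmod (cinner e (A b)))\<^sup>2 + (cmod (cinner b e))\<^sup>2)"
    if "e \<in> E" for e b
  proof -
    have "cmod (cinner e (A b)) * cmod (cinner b e) \<le> (cmod (cinner e (A b)))\<^sup>2 + (cmod (cinner b e))\<^sup>2"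
      using sum_squares_bound[of "cmod (cinner e (A b))" "cmod (cinner b e)"]
        mult_nonneg_nonneg[of "cmod (cinner e (A b))" "cmod (cinner b e)", OF norm_ge_zero norm_ge_zero]
      unfolding mult.assoc by linarith
    then show ?thesis
      unfolding F_def norm_mult norm_of_real mult.assoc using g(1)[OF that]
      by (simp add: mult_left_mono)
  qed
  have F_fin: "(\<Sum>b\<in>Y. cmod (F e b)) \<le> g (l e) * (C\<^sup>2 + 1)" if "e \<in> E" "finite Y" "Y \<subseteq> B" for e Y
  proof -
    have Y: "orthonormal Y"
      using B' that(3) by (rule orthonormal_subset)
    have "(\<Sum>b\<in>Y. cmod (F e b))
        \<le> (\<Sum>b\<in>Y. g (l e) * ((cmod (cinner e (A b)))\<^sup>2 + (cmod (cinner b e))\<^sup>2))"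
      by (intro sum_mono F_le that)
    also have "\<dots> = g (l e) * ((\<Sum>b\<in>Y. (cmod (cinner e (A b)))\<^sup>2) + (\<Sum>b\<in>Y. (cmod (cinner b e))\<^sup>2))"
      by (simp add: sum_distrib_left[symmetric] sum.distrib[symmetric])
    also have "\<dots> \<le> g (l e) * (C\<^sup>2 + 1)"
      using bessel_bounded_op[OF Y that(2) A C norm_E[OF that(1)]]
        bessel_finite[OF Y that(2), of e] norm_E[OF that(1)] g(1)[OF that(1)]
      by (intro mult_left_mono add_mono) auto
    finally show ?thesis .
  qed
  have F_sum: "(\<lambda>b. cmod (F e b)) summable_on B" if "e \<in> E" for e
    by (rule nonneg_bdd_above_summable_on) (auto intro!: bdd_aboveI2 F_fin that)
  have F_inf: "infsum (\<lambda>b. cmod (F e b)) B \<le> g (l e) * (C\<^sup>2 + 1)" if "e \<in> E" for e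
    by (rule infsum_le_finite_sums[OF F_sum[OF that]]) (rule F_fin[OF that])
  have "(\<lambda>p. cmod (case p of (e, b) \<Rightarrow> F e b)) summable_on (E \<times> B)"
    unfolding Infinite_Sum.abs_summable_on_Sigma_iff
  proof (intro conjI ballI)
    show "(\<lambda>b. cmod (case (e, b) of (e, b) \<Rightarrow> F e b)) summable_on B" if "e \<in> E" for e
      using F_sum[OF that] by simp
    have "(\<lambda>e. infsum (\<lambda>b. cmod (F e b)) B) summable_on E"
      by (rule summable_on_comparison_test[OF summable_on_cmult_left[OF sum, of "C\<^sup>2 + 1"]])
         (auto intro: F_inf infsum_nonneg)
    then show "(\<lambda>e. norm (\<Sum>\<^sub>\<infinity>b\<in>B. cmod (case (e, b) of (e, b) \<Rightarrow> F e b))) summable_on E"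
      by (simp add: infsum_nonneg)
  qed
  then have swap: "(\<Sum>\<^sub>\<infinity>e\<in>E. infsum (F e) B) = (\<Sum>\<^sub>\<infinity>b\<in>B. \<Sum>\<^sub>\<infinity>e\<in>E. F e b)"
    using infsum_swap_banach[of F E B] abs_summable_summable by blast
  have "infsum (F e) B = g (l e) * cinner e (A e)" if "e \<in> E" for e
  proof -
    have "((\<lambda>b. A (cinner b e *\<^sub>C b)) has_sum A e) B"
      using bounded_linear_if_bounded_clinear[OF A] onb_expansion[OF B]
      by (rule has_sum_bounded_linear)
    then have "((\<lambda>b. cinner e (A (cinner b e *\<^sub>C b))) has_sum cinner e (A e)) B"
      by (rule has_sum_bounded_linear[OF bounded_linear_cinner])
    then have "((\<lambda>b. g (l e) * cinner e (A (cinner b e *\<^sub>C b))) has_sum g (l e) * cinner e (A e)) B"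
      by (rule has_sum_cmult_right)
    then have "(F e has_sum g (l e) * cinner e (A e)) B"
      by (simp add: F_def[abs_def] bounded_clinear_scaleC[OF A] cinner_scaleC_right mult_ac)
    then show ?thesis
      by (rule infsumI)
  qed
  then have "(\<Sum>\<^sub>\<infinity>e\<in>E. infsum (F e) B) = (\<Sum>\<^sub>\<infinity>e\<in>E. g (l e) * cinner e (A e))"
    by (rule infsum_cong)
  moreover have "(\<Sum>\<^sub>\<infinity>e\<in>E. F e b) = cinner b (?T (A b))" for b
  proof (rule infsumI)
    have "((\<lambda>e. cinner e (?T (A b)) * cinner b e) has_sum cinner b (?T (A b))) E"
      by (rule onb_parseval_cinner[OF onb])
    then show "((\<lambda>e. F e b) has_sum cinner b (?T (A b))) E"
      by (rule has_sum_cong[THEN iffD1, rotated]) (simp add: F_def T_coeff)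
  qed
  ultimately show ?thesis
    using swap by simp
qed

text \<open>The chosen basis in \<open>op_trace\<close> is unrelated to \<open>E\<close>;
  \<open>onb\<close> guarantees that the choice is a basis at all.\<close>

lemma op_trace_op_fun_compose:
  assumes "\<And>e. e \<in> E \<Longrightarrow> 0 \<le> g (l e)" "\<And>e. e \<in> E \<Longrightarrow> g (l e) \<le> K"
    and "(\<lambda>e. g (l e)) summable_on E" and "bounded_clinear A"
  shows "op_trace (op_fun V D g \<circ> A) = (\<Sum>\<^sub>\<infinity>e\<in>E. g (l e) * cinner e (A e))"
proof -
  have "is_onb (SOME B :: 'h set. is_onb B)"
    using onb by (rule someI)
  then show ?thesis
    unfolding op_trace_def comp_apply by (intro infsum_trace_op_fun[of g, OF assms])
qed

lemma op_trace_op_fun: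
  assumes "\<And>e. e \<in> E \<Longrightarrow> 0 \<le> g (l e)" "\<And>e. e \<in> E \<Longrightarrow> g (l e) \<le> K"
    and "(\<lambda>e. g (l e)) summable_on E"
  shows "op_trace (op_fun V D g) = complex_of_real (\<Sum>\<^sub>\<infinity>e\<in>E. g (l e))"
proof -
  have "bounded_clinear (id :: 'h \<Rightarrow> 'h)"
    by (simp add: bounded_clinear_def id_def bounded_linear_ident)
  from op_trace_op_fun_compose[of g, OF assms this]
  have "op_trace (op_fun V D g) = (\<Sum>\<^sub>\<infinity>e\<in>E. g (l e) * cinner e e)"
    by simp
  also have "\<dots> = (\<Sum>\<^sub>\<infinity>e\<in>E. complex_of_real (g (l e)))"
    by (intro infsum_cong) (simp add: cinner_self norm_E)
  also have "\<dots> = complex_of_real (\<Sum>\<^sub>\<infinity>e\<in>E. g (l e))"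
    by (rule infsumI[OF has_sum_of_real[OF has_sum_infsum[OF assms(3)]]])
  finally show ?thesis .
qed

end

section \<open>Mellin transform of a heat series\<close>

lemma integrable_indicator_exp:
  fixes c X :: real
  assumes "c > 0"
  shows "integrable lborel (\<lambda>x. indicator {X..} x * exp (- c * x))"
proof -
  have "(\<lambda>x. exp (- c * x)) integrable_on {X..}"
    using has_integral_exp_minus_to_infinity[OF assms, of X] by (simp add: has_integral_integrable)
  then have "(\<lambda>x. exp (- c * x)) absolutely_integrable_on {X..}"
    by (intro nonnegative_absolutely_integrable_1) auto
  then have "integrable lebesgue (\<lambda>x. indicator {X..} x * exp (- c * x))"
    by (simp add: set_integrable_def)
  then show ?thesis
    by (subst (asm) integrable_completion) simp_all
qed

text \<open>After the substitution \<open>x = - ln t\<close>, this is the integrand of Euler's integral for the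
  Gamma function.\<close>

lemma integrable_gumbel:
  fixes w :: real
  assumes "w > 0"
  shows "integrable lborel (\<lambda>x. exp (- w * x - exp (- x)))"
proof -
  \<comment> \<open>For negative x, exp (- x) is at least 1 - x + x^2 / 2; together with (w + 1 +
    x)^2 \<ge> 0 this bounds the exponent by (w + 1)^2 / 2 + x, so C exp x is a majorant on the
    negative axis.\<close>
  define C where "C = exp ((w + 1)\<^sup>2 / 2)"
  define F where "F x = indicator {0..} x * exp (- w * x) + C * (indicator {0..} (- x) * exp (- 1 * (- x)))"
    for x :: real
  have i1: "integrable lborel (\<lambda>x::real. indicator {0..} x * exp (- w * x))"
    using assms by (rule integrable_indicator_exp)
  have "integrable lborel (\<lambda>x::real. indicator {0..} (0 + (- 1) * x) * exp (- 1 * (0 + (- 1) * x)))"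
    by (rule lborel_integrable_real_affine[OF integrable_indicator_exp]) auto
  then have i2: "integrable lborel (\<lambda>x::real. indicator {0..} (- x) * exp (- 1 * (- x)))"
    by simp
  have "integrable lborel F"
    unfolding F_def by (intro Bochner_Integration.integrable_add integrable_mult_right i1 i2)
  then show ?thesis
  proof (rule Bochner_Integration.integrable_bound)
    have "exp (- w * x - exp (- x)) \<le> F x" for x
    proof (cases "x \<ge> 0")
      case True
      have "exp (- w * x - exp (- x)) \<le> exp (- w * x)"
        by simp
      moreover have "0 \<le> C * (indicator {0..} (- x) * exp (- 1 * (- x)))"
        by (simp add: C_def)
      moreover have "F x = exp (- w * x) + C * (indicator {0..} (- x) * exp (- 1 * (- x)))"
        using True by (simp add: F_def)
      ultimately show ?thesis
        by linarith
    next
      case False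
      have "1 + (- x) + (- x)\<^sup>2 / 2 \<le> exp (- x)"
        using False by (intro exp_lower_Taylor_quadratic) auto
      moreover have "(w + 1 + x)\<^sup>2 = (w + 1)\<^sup>2 + (- x)\<^sup>2 + 2 * (w * x) + 2 * x"
        by (simp add: power2_eq_square algebra_simps)
      moreover have "0 \<le> (w + 1 + x)\<^sup>2"
        by simp
      ultimately have "- w * x - exp (- x) \<le> (w + 1)\<^sup>2 / 2 + x"
        using False by linarith
      then have "exp (- w * x - exp (- x)) \<le> C * exp x"
        by (simp add: C_def flip: exp_add)
      then show ?thesis
        using False by (simp add: F_def)
    qed
    then show "AE x in lborel. norm (exp (- w * x - exp (- x))) \<le> norm (F x)"
      by (intro always_eventually allI) (simp, smt (verit))
  qed simp
qed

text \<open>The value is Gamma(w), and at w = 1 the integrand is the Gumbel density. Only positivity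
  and boundedness on compact intervals matter below, since this factor cancels.\<close>

definition gumbel_integral :: "real \<Rightarrow> real" where
  "gumbel_integral w = (LINT x|lborel. exp (- w * x - exp (- x)))"

lemma gumbel_integral_pos:
  assumes "w > 0"
  shows "gumbel_integral w > 0"
proof -
  have "(LINT x|lborel. indicator {0..1::real} x * exp (- w - 1)) \<le> gumbel_integral w"
    unfolding gumbel_integral_def
  proof (rule Bochner_Integration.integral_mono)
    show "integrable lborel (\<lambda>x::real. indicator {0..1} x * exp (- w - 1))"
      by simp
    show "indicator {0..1} x * exp (- w - 1) \<le> exp (- w * x - exp (- x))" for x
    proof (cases "x \<in> {0..1}")
      case True
      then have "w * x \<le> w * 1" "exp (- x) \<le> 1"
        using assms by (auto intro: mult_left_mono)
      then have "- w - 1 \<le> - w * x - exp (- x)"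
        by linarith
      then show ?thesis
        using True by simp
    qed simp
  qed (rule integrable_gumbel[OF assms])
  moreover have "(LINT x|lborel. indicator {0..1::real} x * exp (- w - 1)) = exp (- w - 1)"
    by simp
  ultimately show ?thesis
    by (smt (verit) exp_gt_zero)
qed

text \<open>As a function of the exponent, the integrand decreases for x \<ge> 0 and increases for x
  < 0, so one endpoint dominates on each half-line. This bounds the Gamma factor uniformly to the
  right of the abscissa.\<close>

lemma gumbel_integral_le_add:
  assumes "0 < v" "v \<le> w" "w \<le> z"
  shows "gumbel_integral w \<le> gumbel_integral v + gumbel_integral z"
proof -
  have int: "integrable lborel (\<lambda>x. exp (- v * x - exp (- x)))" "integrable lborel (\<lambda>x. exp (- z * x - exp (- x)))"
    "integrable lborel (\<lambda>x. exp (- w * x - exp (- x)))"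
    by (rule integrable_gumbel, use assms in linarith)+
  have "exp (- w * x - exp (- x)) \<le> exp (- v * x - exp (- x)) + exp (- z * x - exp (- x))" for x
  proof (cases "x \<ge> 0")
    case True
    then have "exp (- w * x - exp (- x)) \<le> exp (- v * x - exp (- x))"
      using assms by (simp add: mult_right_mono)
    then show ?thesis
      by (smt (verit) exp_gt_zero)
  next
    case False
    then have "exp (- w * x - exp (- x)) \<le> exp (- z * x - exp (- x))"
      using assms by (simp add: mult_right_mono_neg)
    then show ?thesis
      by (smt (verit) exp_gt_zero)
  qed
  then have "gumbel_integral w \<le> (LINT x|lborel. exp (- v * x - exp (- x)) + exp (- z * x - exp (- x)))"
    unfolding gumbel_integral_def using int by (intro Bochner_Integration.integral_mono Bochner_Integration.integrable_add)
  also have "\<dots> = gumbel_integral v + gumbel_integral z"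
    unfolding gumbel_integral_def by (rule Bochner_Integration.integral_add[OF int(1,2)])
  finally show ?thesis .
qed

lemma gumbel_scale:
  fixes w \<mu> :: real
  assumes "w > 0" "\<mu> > 0"
  shows "integrable lborel (\<lambda>x. exp (- w * x - \<mu> * exp (- x)))"
    and "(LINT x|lborel. exp (- w * x - \<mu> * exp (- x))) = \<mu> powr (- w) * gumbel_integral w"
proof -
  define g where "g x = exp (- w * x - \<mu> * exp (- x))" for x
  have g: "g (ln \<mu> + 1 * y) = \<mu> powr (- w) * exp (- w * y - exp (- y))" for y
  proof -
    have "exp (- (ln \<mu> + y)) = inverse \<mu> * exp (- y)"
      using assms by (simp add: exp_add exp_minus exp_diff field_simps)
    then have "g (ln \<mu> + y) = exp (- w * ln \<mu> + (- w * y - exp (- y)))"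
      using assms by (simp add: g_def algebra_simps)
    also have "\<dots> = \<mu> powr (- w) * exp (- w * y - exp (- y))"
      using assms by (simp add: powr_def flip: exp_add)
    finally show ?thesis
      by simp
  qed
  have "integrable lborel (\<lambda>y. g (ln \<mu> + 1 * y))"
    unfolding g by (intro integrable_mult_right integrable_gumbel assms)
  then show "integrable lborel (\<lambda>x. exp (- w * x - \<mu> * exp (- x)))"
    using lborel_integrable_real_affine_iff[of 1 g "ln \<mu>"] by (simp add: g_def[abs_def])
  have "integral\<^sup>L lborel g = (LINT y|lborel. g (ln \<mu> + 1 * y))"
    using lborel_integral_real_affine[of 1 g "ln \<mu>"] by simp
  also have "\<dots> = \<mu> powr (- w) * gumbel_integral w"
    unfolding g gumbel_integral_def by simp
  finally show "(LINT x|lborel. exp (- w * x - \<mu> * exp (- x))) = \<mu> powr (- w) * gumbel_integral w"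
    by (simp add: g_def[abs_def])
qed

lemma eventually_at_right_0_exp_minus:
  assumes "\<forall>\<^sub>F t in at_right (0::real). P t"
  shows "\<exists>X\<ge>0. \<forall>x\<ge>X. P (exp (- x))"
proof -
  obtain d where d: "d > 0" "\<And>t. 0 < t \<Longrightarrow> t < d \<Longrightarrow> P t"
    using assms unfolding eventually_at_right_field by auto
  \<comment> \<open>The 1 makes \<open>exp (- x) < d\<close> strict; the maximum with 0 keeps x in
    the domain on which f is controlled.\<close>
  show ?thesis
  proof (intro exI[of _ "max 0 (1 - ln d)"] conjI allI impI)
    fix x assume "max 0 (1 - ln d) \<le> x"
    then have "exp (- x) < exp (ln d)"
      by (subst exp_less_cancel_iff) auto
    then show "P (exp (- x))"
      using d by simp
  qed simp
qed

text \<open>Series over the naturals, so that termwise integration applies. In the application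
  \<open>\<mu>\<close> lists the squared eigenvalues and \<open>p\<close> is 1 on genuine indices
  and 0 on padding, which treats finite and infinite bases alike. Consequently \<open>zeta w\<close>
  is the spectral zeta function at 2 w.\<close>

locale heat_series =
  fixes p \<mu> :: "nat \<Rightarrow> real" and m :: real
  assumes p_nonneg: "0 \<le> p n"
    and gap: "0 < m" "m \<le> \<mu> n"
    and summable_heat: "0 < t \<Longrightarrow> summable (\<lambda>n. p n * exp (- t * \<mu> n))"
begin

definition heat :: "real \<Rightarrow> real" where
  "heat t = (\<Sum>n. p n * exp (- t * \<mu> n))"

definition zeta :: "real \<Rightarrow> real" where
  "zeta w = (\<Sum>n. p n * \<mu> n powr (- w))"

lemma \<mu>_pos: "0 < \<mu> n"
  using gap less_le_trans by blast

lemma heat_nonneg: "0 < t \<Longrightarrow> 0 \<le> heat t"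
  unfolding heat_def by (intro suminf_nonneg summable_heat) (auto simp: p_nonneg)

lemma exp_split: "exp (- w * x - \<mu> n * exp (- x)) = exp (- w * x) * exp (- exp (- x) * \<mu> n)"
  by (simp add: mult.commute flip: exp_add)

lemma summable_kernel: "summable (\<lambda>n. p n * exp (- w * x - \<mu> n * exp (- x)))"
  unfolding exp_split using summable_mult[OF summable_heat[of "exp (- x)"], of "exp (- w * x)"]
  by (simp add: mult_ac)

lemma suminf_kernel: "(\<Sum>n. p n * exp (- w * x - \<mu> n * exp (- x))) = exp (- w * x) * heat (exp (- x))"
  unfolding exp_split heat_def using suminf_mult[OF summable_heat[of "exp (- x)"], of "exp (- w * x)"]
  by (simp add: mult_ac)

text \<open>Raising the time from exp (- X) to exp (- x) multiplies the n-th term by the exponential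
  of \<open>- \<mu> n\<close> times the increase, and \<open>m \<le> \<mu> n\<close> makes this
  factor uniform in n. It controls the Mellin integrand as x tends to minus infinity.\<close>

lemma heat_decay:
  assumes "x \<le> X"
  shows "heat (exp (- x)) \<le> heat (exp (- X)) * exp (m * exp (- X)) * exp (- m * exp (- x))"
proof -
  define k where "k = exp (m * exp (- X)) * exp (- m * exp (- x))"
  have le: "p n * exp (- exp (- x) * \<mu> n) \<le> p n * exp (- exp (- X) * \<mu> n) * k" for n
  proof -
    have "(exp (- x) - exp (- X)) * m \<le> (exp (- x) - exp (- X)) * \<mu> n"
      using assms gap by (intro mult_left_mono) auto
    then have "exp (- exp (- x) * \<mu> n) \<le> exp (- exp (- X) * \<mu> n) * k"
      unfolding k_def by (simp add: algebra_simps flip: exp_add)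
    then show ?thesis
      using p_nonneg by (simp add: mult_left_mono mult.assoc)
  qed
  have "heat (exp (- x)) \<le> (\<Sum>n. p n * exp (- exp (- X) * \<mu> n) * k)"
    unfolding heat_def by (intro suminf_le le summable_heat summable_mult2) auto
  also have "\<dots> = heat (exp (- X)) * k"
    unfolding heat_def by (intro suminf_mult2[symmetric] summable_heat) auto
  finally show ?thesis
    by (simp add: k_def mult.assoc)
qed

text \<open>The Mellin transform, with \<open>t = exp (- x)\<close>.\<close>

lemma mellin:
  fixes b :: "nat \<Rightarrow> 'a::{banach, second_countable_topology}"
  assumes b: "\<And>n. norm (b n) \<le> K * p n" and w: "w > 0"
    and sum: "summable (\<lambda>n. p n * \<mu> n powr (- w))"
  shows "integrable lborel (\<lambda>x. \<Sum>n. exp (- w * x - \<mu> n * exp (- x)) *\<^sub>R b n)" (is ?A)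
    and "(LINT x|lborel. (\<Sum>n. exp (- w * x - \<mu> n * exp (- x)) *\<^sub>R b n))
      = gumbel_integral w *\<^sub>R (\<Sum>n. \<mu> n powr (- w) *\<^sub>R b n)" (is ?B)
proof -
  define F where "F n x = exp (- w * x - \<mu> n * exp (- x)) *\<^sub>R b n" for n x
  have F_int: "integrable lborel (F n)" for n
    unfolding F_def by (intro integrable_scaleR_left gumbel_scale w \<mu>_pos)
  have F_eq: "integral\<^sup>L lborel (F n) = gumbel_integral w *\<^sub>R (\<mu> n powr (- w) *\<^sub>R b n)" for n
    unfolding F_def using gumbel_scale[OF w \<mu>_pos[of n]] by (simp add: mult.commute)
  have F_norm: "(LINT x|lborel. norm (F n x)) = \<mu> n powr (- w) * gumbel_integral w * norm (b n)" for n
    unfolding F_def using gumbel_scale[OF w \<mu>_pos[of n]] by simp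
  have "summable (\<lambda>n. norm (F n x))" for x
  proof (rule summable_comparison_test')
    show "summable (\<lambda>n. K * (p n * exp (- w * x - \<mu> n * exp (- x))))"
      by (intro summable_mult summable_kernel)
    show "norm (norm (F n x)) \<le> K * (p n * exp (- w * x - \<mu> n * exp (- x)))" for n
      using mult_left_mono[OF b[of n], of "exp (- w * x - \<mu> n * exp (- x))"]
      by (simp add: F_def mult_ac)
  qed
  then have F_ae: "AE x in lborel. summable (\<lambda>n. norm (F n x))"
    by simp
  have zeta_sum: "summable (\<lambda>n. norm (\<mu> n powr (- w) *\<^sub>R b n))"
  proof (rule summable_comparison_test')
    show "summable (\<lambda>n. K * (p n * \<mu> n powr (- w)))"
      by (intro summable_mult sum)
    show "norm (norm (\<mu> n powr (- w) *\<^sub>R b n)) \<le> K * (p n * \<mu> n powr (- w))" for n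
      using mult_left_mono[OF b[of n], of "\<mu> n powr (- w)"] by (simp add: mult_ac)
  qed
  \<comment> \<open>The L1 norms of the terms scale exactly by \<open>\<mu> n powr (- w)\<close>, so
    convergence of the zeta series is what permits integration term by term.\<close>
  then have F_sum: "summable (\<lambda>n. LINT x|lborel. norm (F n x))"
    unfolding F_norm using summable_mult[OF zeta_sum, of "gumbel_integral w"] by (simp add: mult_ac)
  show ?A
    using integrable_suminf[OF F_int F_ae F_sum] by (simp add: F_def)
  have "(LINT x|lborel. (\<Sum>n. F n x)) = (\<Sum>n. gumbel_integral w *\<^sub>R (\<mu> n powr (- w) *\<^sub>R b n))"
    using integral_suminf[OF F_int F_ae F_sum] by (simp add: F_eq)
  also have "\<dots> = gumbel_integral w *\<^sub>R (\<Sum>n. \<mu> n powr (- w) *\<^sub>R b n)"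
    by (intro suminf_scaleR_right[symmetric] summable_norm_cancel[OF zeta_sum])
  finally show ?B
    by (simp add: F_def)
qed

lemma mellin_heat:
  assumes "w > 0" "summable (\<lambda>n. p n * \<mu> n powr (- w))"
  shows "integrable lborel (\<lambda>x. exp (- w * x) * heat (exp (- x)))"
    and "(LINT x|lborel. exp (- w * x) * heat (exp (- x))) = gumbel_integral w * zeta w"
  using mellin[of p 1 w] assms p_nonneg unfolding suminf_kernel[symmetric] zeta_def
  by (simp_all add: mult_ac)

text \<open>\<open>mellin\<close> presupposes the convergence sought here, so only finite partial
  sums are integrated. They are nonnegative and dominated by \<open>Bd\<close>, whose first part
  uses the growth bound beyond X and whose second uses \<open>heat_decay\<close> before X.\<close>

lemma summable_zeta:
  assumes growth: "\<And>x. x \<ge> X \<Longrightarrow> heat (exp (- x)) \<le> C * exp (a * x)" and w: "w > a" "w > 0"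
  shows "summable (\<lambda>n. p n * \<mu> n powr (- w))"
proof -
  define C' where "C' = heat (exp (- X)) * exp (m * exp (- X))"
  define Bd where "Bd x = \<bar>C\<bar> * (indicator {X..} x * exp (- (w - a) * x)) + C' * exp (- w * x - m * exp (- x))" for x
  have C': "C' \<ge> 0"
    by (simp add: C'_def heat_nonneg)
  have Bd_int: "integrable lborel Bd"
    unfolding Bd_def using w gap
    by (intro Bochner_Integration.integrable_add integrable_mult_right integrable_indicator_exp gumbel_scale) auto
  have Bd: "exp (- w * x) * heat (exp (- x)) \<le> Bd x" for x
  proof (cases "x \<ge> X")
    case True
    have "exp (- w * x) * heat (exp (- x)) \<le> exp (- w * x) * (\<bar>C\<bar> * exp (a * x))"
      using growth[OF True] by (intro mult_left_mono) (auto intro: order_trans mult_right_mono)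
    also have "\<dots> = \<bar>C\<bar> * exp (- (w - a) * x)"
      by (simp add: algebra_simps flip: exp_add)
    also have "\<dots> \<le> Bd x"
      using True C' by (simp add: Bd_def)
    finally show ?thesis .
  next
    case False
    then have "exp (- w * x) * heat (exp (- x)) \<le> exp (- w * x) * (C' * exp (- m * exp (- x)))"
      unfolding C'_def by (intro mult_left_mono heat_decay) auto
    also have "\<dots> = Bd x"
      using False by (simp add: Bd_def flip: exp_add)
    finally show ?thesis .
  qed
  have G: "gumbel_integral w > 0"
    using w by (intro gumbel_integral_pos)
  show ?thesis
  proof (rule summableI_nonneg_bounded)
    show "0 \<le> p n * \<mu> n powr (- w)" for n
      using p_nonneg by simp
    fix N
    have k_int: "integrable lborel (\<lambda>x. p n * exp (- w * x - \<mu> n * exp (- x)))" for n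
      by (intro integrable_mult_right gumbel_scale w \<mu>_pos)
    have "gumbel_integral w * (\<Sum>n<N. p n * \<mu> n powr (- w))
        = (\<Sum>n<N. (LINT x|lborel. p n * exp (- w * x - \<mu> n * exp (- x))))"
      using gumbel_scale[OF w(2) \<mu>_pos] by (simp add: sum_distrib_left mult_ac)
    also have "\<dots> = (LINT x|lborel. (\<Sum>n<N. p n * exp (- w * x - \<mu> n * exp (- x))))"
      by (intro Bochner_Integration.integral_sum[symmetric] k_int)
    also have "\<dots> \<le> integral\<^sup>L lborel Bd"
    proof (intro Bochner_Integration.integral_mono Bochner_Integration.integrable_sum k_int Bd_int)
      fix x
      have "(\<Sum>n<N. p n * exp (- w * x - \<mu> n * exp (- x))) \<le> (\<Sum>n. p n * exp (- w * x - \<mu> n * exp (- x)))"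
        by (intro sum_le_suminf summable_kernel) (auto simp: p_nonneg)
      then show "(\<Sum>n<N. p n * exp (- w * x - \<mu> n * exp (- x))) \<le> Bd x"
        unfolding suminf_kernel using Bd order_trans by blast
    qed
    finally show "(\<Sum>n<N. p n * \<mu> n powr (- w)) \<le> integral\<^sup>L lborel Bd / gumbel_integral w"
      using G by (simp add: field_simps)
  qed
qed

text \<open>Domination of |f| by the heat series gives |L[f](u)| \<le> I + 2 Gamma(a + u) zeta(a +
  u), where \<open>I\<close> accounts for [0, X]. The left side grows like |L| / u, while the Gamma
  factor stays below \<open>G\<close> for u < 1, so the zeta factor has to diverge.\<close>

lemma zeta_at_top:
  assumes a: "a > 0" and summable: "\<And>w. w > a \<Longrightarrow> summable (\<lambda>n. p n * \<mu> n powr (- w))"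
    and X: "X \<ge> 0" "\<And>x. x \<ge> X \<Longrightarrow> \<bar>f x\<bar> \<le> 2 * (heat (exp (- x)) * exp (- a * x))"
    and f: "\<And>b. f absolutely_integrable_on {0..b}" "bounded (f ` {0..})"
    and L: "L \<noteq> 0" "((\<lambda>s. s * laplace f s) \<longlongrightarrow> L) (at_right 0)"
  shows "filterlim zeta at_top (at_right a)"
proof -
  define I where "I = (LINT x:{0..X}|lebesgue. \<bar>f x\<bar>)"
  obtain M where M: "\<And>x. x \<ge> 0 \<Longrightarrow> \<bar>f x\<bar> \<le> M"
    using f(2) unfolding bounded_iff by (auto simp: real_norm_def)
  \<comment> \<open>Integrability of f is only local; measurability on the half-line is recovered as
    a pointwise limit of truncations to [0, n].\<close>
  have f_meas: "(\<lambda>x. indicator {0..} x * f x) \<in> borel_measurable lebesgue"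
  proof (rule borel_measurable_LIMSEQ_real)
    show "(\<lambda>x. indicator {0..real n} x * f x) \<in> borel_measurable lebesgue" for n
      using f(1)[of "real n"] by (simp add: set_integrable_def integrable_iff_bounded)
    show "(\<lambda>n. indicator {0..real n} x * f x) \<longlonglongrightarrow> indicator {0..} x * f x" for x :: real
    proof (rule tendsto_eventually)
      obtain N where "x \<le> real N"
        using real_arch_simple by blast
      then show "\<forall>\<^sub>F n in sequentially. indicator {0..real n} x * f x = indicator {0..} x * f x"
        unfolding eventually_sequentially by (intro exI[of _ N]) (auto simp: indicator_def)
    qed
  qed
  have bound: "\<bar>laplace f u\<bar> \<le> I + 2 * (gumbel_integral (a + u) * zeta (a + u))" if u: "u > 0" for u
  proof -
    define J where "J x = exp (- (a + u) * x) * heat (exp (- x))" for x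
    have w: "a + u > a" "a + u > 0"
      using a u by auto
    have J_int: "integrable lborel J" and J_eq: "integral\<^sup>L lborel J = gumbel_integral (a + u) * zeta (a + u)"
      using mellin_heat[OF w(2) summable[OF w(1)]] by (simp_all add: J_def[abs_def])
    have J_meas: "J \<in> borel_measurable lborel"
      using J_int by (rule borel_measurable_integrable)
    have J_nonneg: "0 \<le> J x" for x
      by (simp add: J_def heat_nonneg)
    \<comment> \<open>\<open>laplace\<close> integrates against the completed measure, the Mellin
      lemmas against Borel measure; for the Borel function \<open>J\<close> the two agree.\<close>
    have J_leb: "integrable lebesgue J" "integral\<^sup>L lebesgue J = integral\<^sup>L lborel J"
      using J_int J_meas by (simp_all add: integrable_completion integral_completion)
    have I_int: "integrable lebesgue (\<lambda>x. indicator {0..X} x * \<bar>f x\<bar>)"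
      using absolutely_integrable_norm[OF f(1)[of X]] by (simp add: set_integrable_def o_def)
    have le: "\<bar>indicator {0..} x * (f x * exp (- u * x))\<bar> \<le> indicator {0..X} x * \<bar>f x\<bar> + 2 * J x" for x
    proof (cases "x \<ge> X")
      case True
      have "\<bar>f x\<bar> * exp (- u * x) \<le> 2 * (heat (exp (- x)) * exp (- a * x)) * exp (- u * x)"
        using X(2)[OF True] by (intro mult_right_mono) auto
      also have "\<dots> = 2 * J x"
        by (simp add: J_def algebra_simps flip: exp_add)
      finally show ?thesis
        using True X(1) by (auto simp: indicator_def abs_mult)
    next
      case False
      have "\<bar>f x\<bar> * exp (- u * x) \<le> \<bar>f x\<bar> * 1" if "x \<ge> 0"
        using that u by (intro mult_left_mono) auto
      then show ?thesis
        using False J_nonneg[of x] by (auto simp: indicator_def abs_mult)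
    qed
    have "\<bar>laplace f u\<bar> \<le> (LINT x|lebesgue. indicator {0..X} x * \<bar>f x\<bar> + 2 * J x)"
      unfolding laplace_def set_lebesgue_integral_def real_scaleR_def real_norm_def[symmetric]
    proof (rule Bochner_Integration.integral_norm_bound_integral)
      show int2: "integrable lebesgue (\<lambda>x. indicator {0..X} x * norm (f x) + 2 * J x)"
        using I_int J_leb(1) by simp
      have "(\<lambda>x. indicator {0..} x * f x * exp (- u * x)) \<in> borel_measurable lebesgue"
        by (intro borel_measurable_times f_meas) (simp add: measurable_completion)
      then have meas: "(\<lambda>x. indicator {0..} x * (f x * exp (- u * x))) \<in> borel_measurable lebesgue"
        by (simp add: mult.assoc)
      show "integrable lebesgue (\<lambda>x. indicator {0..} x * (f x * exp (- u * x)))"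
        by (rule Bochner_Integration.integrable_bound[OF int2 meas])
           (intro always_eventually allI, use le in \<open>simp add: order_trans[OF _ abs_ge_self]\<close>)
      show "norm (indicator {0..} x * (f x * exp (- u * x))) \<le> indicator {0..X} x * norm (f x) + 2 * J x" for x
        using le[of x] by simp
    qed
    also have "\<dots> = I + 2 * integral\<^sup>L lebesgue J"
      using I_int J_leb(1) by (simp add: I_def set_lebesgue_integral_def)
    finally show ?thesis
      by (simp add: J_leb(2) J_eq)
  qed
  define G where "G = gumbel_integral a + gumbel_integral (a + 1)"
  have G_pos: "G > 0"
    using a gumbel_integral_pos[of a] gumbel_integral_pos[of "a + 1"] by (simp add: G_def)
  have zeta_nonneg: "0 \<le> zeta w" if "w > a" for w
    unfolding zeta_def using p_nonneg by (intro suminf_nonneg summable that) auto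
  have zeta_ge: "(\<bar>s * laplace f s\<bar> * inverse s - I) / (2 * G) \<le> zeta (a + s)" if s: "0 < s" "s < 1" for s
  proof -
    have "gumbel_integral (a + s) \<le> G"
      unfolding G_def using a s by (intro gumbel_integral_le_add) auto
    then have "gumbel_integral (a + s) * zeta (a + s) \<le> G * zeta (a + s)"
      using zeta_nonneg[of "a + s"] s by (intro mult_right_mono) auto
    then have "\<bar>laplace f s\<bar> - I \<le> 2 * G * zeta (a + s)"
      using bound[OF s(1)] by simp
    moreover have "\<bar>s * laplace f s\<bar> * inverse s = \<bar>laplace f s\<bar>"
      using s by (simp add: abs_mult)
    ultimately show ?thesis
      using G_pos by (simp add: divide_le_eq mult_ac)
  qed
  have "((\<lambda>s. \<bar>s * laplace f s\<bar>) \<longlongrightarrow> \<bar>L\<bar>) (at_right 0)"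
    using L(2) by (rule tendsto_rabs)
  then have "filterlim (\<lambda>s. \<bar>s * laplace f s\<bar> * inverse s) at_top (at_right 0)"
    using L(1) filterlim_inverse_at_top_right by (intro filterlim_tendsto_pos_mult_at_top[where c = "\<bar>L\<bar>"]) auto
  then have "filterlim (\<lambda>s. - I + \<bar>s * laplace f s\<bar> * inverse s) at_top (at_right 0)"
    by (rule filterlim_tendsto_add_at_top[OF tendsto_const])
  then have "filterlim (\<lambda>s. inverse (2 * G) * (- I + \<bar>s * laplace f s\<bar> * inverse s)) at_top (at_right 0)"
    using G_pos by (intro filterlim_tendsto_pos_mult_at_top[OF tendsto_const]) auto
  then have "filterlim (\<lambda>s. zeta (a + s)) at_top (at_right 0)"
  proof (rule filterlim_at_top_mono)
    have "\<forall>\<^sub>F s in at_right (0::real). 0 < s \<and> s < 1"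
      unfolding eventually_at_right_field by (intro exI[of _ 1]) auto
    then show "\<forall>\<^sub>F s in at_right 0. inverse (2 * G) * (- I + \<bar>s * laplace f s\<bar> * inverse s) \<le> zeta (a + s)"
    proof eventually_elim
      case (elim s)
      then show ?case
        using zeta_ge[of s] by (simp add: field_simps)
    qed
  qed
  then show ?thesis
    unfolding filterlim_at_right_to_0[of _ _ a] by (simp add: add.commute)
qed

text \<open>Convergence at some w \<le> a would bound zeta near a: for z > a each term at z is at
  most \<open>m powr (- (z - w))\<close> times the term at w, a factor with a finite limit at
  a.\<close>

lemma not_summable_zeta:
  assumes "filterlim zeta at_top (at_right a)" "w \<le> a"
    and summable: "\<And>w. w > a \<Longrightarrow> summable (\<lambda>n. p n * \<mu> n powr (- w))"
  shows "\<not> summable (\<lambda>n. p n * \<mu> n powr (- w))"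
proof
  assume sum: "summable (\<lambda>n. p n * \<mu> n powr (- w))"
  have zeta_le: "zeta z \<le> m powr (- (z - w)) * zeta w" if "z > a" for z
  proof -
    have "p n * \<mu> n powr (- z) \<le> m powr (- (z - w)) * (p n * \<mu> n powr (- w))" for n
    proof -
      have "\<mu> n powr (- z) = \<mu> n powr (- (z - w)) * \<mu> n powr (- w)"
        by (simp flip: powr_add)
      also have "\<dots> \<le> m powr (- (z - w)) * \<mu> n powr (- w)"
        using gap that assms(2) by (intro mult_right_mono powr_mono2') auto
      finally show ?thesis
        using p_nonneg[of n] by (simp add: mult_left_mono mult.left_commute)
    qed
    then have "zeta z \<le> (\<Sum>n. m powr (- (z - w)) * (p n * \<mu> n powr (- w)))"
      unfolding zeta_def by (intro suminf_le summable that summable_mult sum)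
    then show ?thesis
      unfolding zeta_def by (simp add: suminf_mult[OF sum])
  qed
  have "((\<lambda>z. m powr (- (z - w)) * zeta w) \<longlongrightarrow> m powr (- (a - w)) * zeta w) (at_right a)"
    using gap by (intro tendsto_intros) auto
  moreover have "\<forall>\<^sub>F z in at_right a. zeta z \<le> m powr (- (z - w)) * zeta w"
    using eventually_at_right_less by (rule eventually_mono) (rule zeta_le)
  then have "filterlim (\<lambda>z. m powr (- (z - w)) * zeta w) at_top (at_right a)"
    by (rule filterlim_at_top_mono[OF assms(1)])
  ultimately show False
    using not_tendsto_and_filterlim_at_infinity[of "at_right a"] filterlim_at_top_imp_at_infinity
      trivial_limit_at_right_real by blast
qed

text \<open>For \<open>x \<ge> X\<close> the integrand of the numerator is at most \<open>\<epsilon>\<close> times that of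
  \<open>gumbel_integral w * zeta w\<close>; the part with \<open>x \<le> X\<close> stays bounded while \<open>zeta w\<close> tends to
  infinity.\<close>

lemma zeta_quotient_tendsto_0:
  fixes b :: "nat \<Rightarrow> complex"
  assumes a: "a > 0" and summable: "\<And>w. w > a \<Longrightarrow> summable (\<lambda>n. p n * \<mu> n powr (- w))"
    and zeta: "filterlim zeta at_top (at_right a)"
    and b: "\<And>n. norm (b n) \<le> K * p n"
    and small: "\<And>\<epsilon>. \<epsilon> > 0 \<Longrightarrow> \<exists>X. \<forall>x\<ge>X. norm (\<Sum>n. exp (- exp (- x) * \<mu> n) *\<^sub>R b n) \<le> \<epsilon> * heat (exp (- x))"
  shows "((\<lambda>w. (\<Sum>n. \<mu> n powr (- w) *\<^sub>R b n) / complex_of_real (zeta w)) \<longlongrightarrow> 0) (at_right a)"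
proof (rule tendstoI)
  fix \<epsilon> :: real assume "\<epsilon> > 0"
  then obtain X where X: "\<And>x. x \<ge> X \<Longrightarrow> norm (\<Sum>n. exp (- exp (- x) * \<mu> n) *\<^sub>R b n) \<le> \<epsilon> / 2 * heat (exp (- x))"
    using small[of "\<epsilon> / 2"] by auto
  define C' where "C' = \<bar>K\<bar> * (heat (exp (- X)) * exp (m * exp (- X)))"
  have C': "C' \<ge> 0"
    by (simp add: C'_def heat_nonneg)
  define B where "B w x = (\<Sum>n. exp (- w * x - \<mu> n * exp (- x)) *\<^sub>R b n)" for w x
  have sum_b: "summable (\<lambda>n. exp (- exp (- x) * \<mu> n) *\<^sub>R b n)" for x
  proof (rule summable_comparison_test')
    show "summable (\<lambda>n. K * (p n * exp (- exp (- x) * \<mu> n)))"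
      by (intro summable_mult summable_heat) auto
    show "norm (exp (- exp (- x) * \<mu> n) *\<^sub>R b n) \<le> K * (p n * exp (- exp (- x) * \<mu> n))" for n
      using mult_left_mono[OF b[of n], of "exp (- exp (- x) * \<mu> n)"] by (simp add: mult_ac)
  qed
  have B_eq: "B w x = exp (- w * x) *\<^sub>R (\<Sum>n. exp (- exp (- x) * \<mu> n) *\<^sub>R b n)" for w x
    unfolding B_def exp_split using suminf_scaleR_right[OF sum_b, of "exp (- w * x)" x] by simp
  have crude: "norm (\<Sum>n. exp (- exp (- x) * \<mu> n) *\<^sub>R b n) \<le> \<bar>K\<bar> * heat (exp (- x))" for x
  proof -
    have le: "norm (exp (- exp (- x) * \<mu> n) *\<^sub>R b n) \<le> \<bar>K\<bar> * (p n * exp (- exp (- x) * \<mu> n))" for n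
    proof -
      have "norm (b n) \<le> \<bar>K\<bar> * p n"
        using b[of n] mult_right_mono[OF abs_ge_self[of K] p_nonneg[of n]] by linarith
      then show ?thesis
        using mult_left_mono[of "norm (b n)" "\<bar>K\<bar> * p n" "exp (- exp (- x) * \<mu> n)"] by (simp add: mult_ac)
    qed
    have s: "summable (\<lambda>n. \<bar>K\<bar> * (p n * exp (- exp (- x) * \<mu> n)))"
      by (intro summable_mult summable_heat) auto
    have "norm (\<Sum>n. exp (- exp (- x) * \<mu> n) *\<^sub>R b n) \<le> (\<Sum>n. \<bar>K\<bar> * (p n * exp (- exp (- x) * \<mu> n)))"
      using le s by (rule norm_suminf_le)
    also have "\<dots> = \<bar>K\<bar> * heat (exp (- x))"
      unfolding heat_def by (intro suminf_mult summable_heat) auto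
    finally show ?thesis .
  qed
  \<comment> \<open>Each summand is valid as a bound on one side of X but is kept on the whole line:
    both integrals then have closed forms containing \<open>gumbel_integral w\<close>, and after
    cancelling it the second leaves only \<open>C' * m powr (- w)\<close>, bounded near a.\<close>
  have B_le: "norm (B w x) \<le> \<epsilon> / 2 * (exp (- w * x) * heat (exp (- x))) + C' * exp (- w * x - m * exp (- x))" for w x
  proof (cases "x \<ge> X")
    case True
    have "norm (B w x) \<le> exp (- w * x) * (\<epsilon> / 2 * heat (exp (- x)))"
      unfolding B_eq norm_scaleR using X[OF True] by (simp add: mult_left_mono)
    moreover have "0 \<le> C' * exp (- w * x - m * exp (- x))"
      using C' by simp
    ultimately show ?thesis
      by (simp add: mult_ac)
  next
    case False
    have "\<bar>K\<bar> * heat (exp (- x)) \<le> \<bar>K\<bar> * (heat (exp (- X)) * exp (m * exp (- X)) * exp (- m * exp (- x)))"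
      using False by (intro mult_left_mono heat_decay) auto
    then have "norm (\<Sum>n. exp (- exp (- x) * \<mu> n) *\<^sub>R b n) \<le> C' * exp (- m * exp (- x))"
      using crude[of x] by (simp add: C'_def mult.assoc)
    then have "norm (B w x) \<le> exp (- w * x) * (C' * exp (- m * exp (- x)))"
      unfolding B_eq norm_scaleR by (simp add: mult_left_mono)
    also have "\<dots> = C' * exp (- w * x - m * exp (- x))"
      by (simp flip: exp_add)
    finally show ?thesis
      using \<open>\<epsilon> > 0\<close> heat_nonneg[of "exp (- x)"] by (smt (verit) divide_pos_pos exp_gt_zero mult_nonneg_nonneg)
  qed
  have main: "norm (\<Sum>n. \<mu> n powr (- w) *\<^sub>R b n) \<le> \<epsilon> / 2 * zeta w + C' * m powr (- w)" if "w > a" for w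
  proof -
    have w: "w > 0"
      using that a by simp
    note sw = summable[OF that]
    have G: "gumbel_integral w > 0"
      by (rule gumbel_integral_pos[OF w])
    have h: "integrable lborel (\<lambda>x. \<epsilon> / 2 * (exp (- w * x) * heat (exp (- x))))"
      "integrable lborel (\<lambda>x. C' * exp (- w * x - m * exp (- x)))"
      by (intro integrable_mult_right mellin_heat[OF w sw] gumbel_scale[OF w gap(1)])+
    have "gumbel_integral w * norm (\<Sum>n. \<mu> n powr (- w) *\<^sub>R b n) = norm (LINT x|lborel. B w x)"
      unfolding B_def mellin(2)[OF b w sw] using G by simp
    also have "\<dots> \<le> (LINT x|lborel. \<epsilon> / 2 * (exp (- w * x) * heat (exp (- x))) + C' * exp (- w * x - m * exp (- x)))"
      by (rule Bochner_Integration.integral_norm_bound_integral[OF _ Bochner_Integration.integrable_add[OF h] B_le])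
         (unfold B_def, rule mellin(1)[OF b w sw])
    also have "\<dots> = \<epsilon> / 2 * (gumbel_integral w * zeta w) + C' * (m powr (- w) * gumbel_integral w)"
      unfolding Bochner_Integration.integral_add[OF h]
      by (simp only: integral_mult_right_zero mellin_heat(2)[OF w sw] gumbel_scale(2)[OF w gap(1)])
    also have "\<dots> = gumbel_integral w * (\<epsilon> / 2 * zeta w + C' * m powr (- w))"
      by (simp add: algebra_simps)
    finally show ?thesis
      using G by simp
  qed
  have "((\<lambda>w. C' * m powr (- w)) \<longlongrightarrow> C' * m powr (- a)) (at_right a)"
    using gap by (intro tendsto_intros) auto
  then have "((\<lambda>w. C' * m powr (- w) / zeta w) \<longlongrightarrow> 0) (at_right a)"
    using zeta by (intro tendsto_divide_0 filterlim_at_top_imp_at_infinity)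
  then have "\<forall>\<^sub>F w in at_right a. C' * m powr (- w) / zeta w < \<epsilon> / 2"
    by (rule order_tendstoD) (use \<open>\<epsilon> > 0\<close> in simp)
  moreover have "\<forall>\<^sub>F w in at_right a. zeta w > 0"
    using zeta by (simp add: filterlim_at_top_dense)
  moreover have "\<forall>\<^sub>F w in at_right a. w > a"
    by (rule eventually_at_right_less)
  ultimately show "\<forall>\<^sub>F w in at_right a.
      dist ((\<Sum>n. \<mu> n powr (- w) *\<^sub>R b n) / complex_of_real (zeta w)) 0 < \<epsilon>"
  proof eventually_elim
    case (elim w)
    have "dist ((\<Sum>n. \<mu> n powr (- w) *\<^sub>R b n) / complex_of_real (zeta w)) 0
        = norm (\<Sum>n. \<mu> n powr (- w) *\<^sub>R b n) / zeta w"
      using elim(2) by (simp add: norm_divide)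
    also have "\<dots> \<le> (\<epsilon> / 2 * zeta w + C' * m powr (- w)) / zeta w"
      using elim(2) main[OF elim(3)] by (intro divide_right_mono) auto
    also have "\<dots> = \<epsilon> / 2 + C' * m powr (- w) / zeta w"
      using elim(2) by (simp add: add_divide_distrib)
    also have "\<dots> < \<epsilon>"
      using elim(1) by linarith
    finally show ?case .
  qed
qed

end

section \<open>Strong regularity and the zeta function\<close>

text \<open>Padding by zero off the image of \<open>to_nat_on\<close> avoids a case distinction
  between finite and infinite \<open>E\<close>.\<close>

lemma has_sum_enumerate:
  assumes "countable E"
  shows "(F has_sum S) E \<longleftrightarrow>
    ((\<lambda>n. if n \<in> to_nat_on E ` E then F (from_nat_into E n) else 0) has_sum S) UNIV"
proof -
  have "((\<lambda>n. F (from_nat_into E n)) has_sum S) (to_nat_on E ` E)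
      \<longleftrightarrow> (((\<lambda>n. F (from_nat_into E n)) \<circ> to_nat_on E) has_sum S) E"
    by (rule has_sum_reindex[OF inj_on_to_nat_on[OF assms]])
  moreover have "\<dots> \<longleftrightarrow> (F has_sum S) E"
    by (rule has_sum_cong) (simp add: assms)
  moreover have "((\<lambda>n. if n \<in> to_nat_on E ` E then F (from_nat_into E n) else 0) has_sum S) UNIV
      \<longleftrightarrow> ((\<lambda>n. F (from_nat_into E n)) has_sum S) (to_nat_on E ` E)"
    by (rule has_sum_cong_neutral) auto
  ultimately show ?thesis
    by simp
qed

lemma sums_enumerate:
  assumes "countable E" "(F has_sum S) E"
  shows "(\<lambda>n. if n \<in> to_nat_on E ` E then F (from_nat_into E n) else 0) sums S"
  using has_sum_enumerate[OF assms(1)] assms(2) by (intro has_sum_imp_sums) blast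

lemma summable_enumerate_iff:
  fixes F :: "'a \<Rightarrow> real"
  assumes "countable E" "\<And>e. e \<in> E \<Longrightarrow> 0 \<le> F e"
  shows "F summable_on E \<longleftrightarrow> summable (\<lambda>n. if n \<in> to_nat_on E ` E then F (from_nat_into E n) else 0)"
    (is "_ \<longleftrightarrow> summable ?G")
proof -
  have "?G summable_on UNIV \<longleftrightarrow> summable ?G"
    using assms by (intro summable_on_UNIV_nonneg_real_iff) auto
  then show ?thesis
    unfolding summable_on_def has_sum_enumerate[OF assms(1)] by blast
qed

context eigenbasis
begin

text \<open>The coefficients \<open>cinner e (A e) - c\<close> do not depend on g. Hence the heat
  difference and the zeta difference are series with the same coefficients, which is what the Mellin
  argument compares.\<close>

lemma op_fun_has_sum:
  assumes g: "\<And>e. e \<in> E \<Longrightarrow> 0 \<le> g (l e)" "\<And>e. e \<in> E \<Longrightarrow> g (l e) \<le> K"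
    and sum: "(\<lambda>e. g (l e)) summable_on E" and A: "bounded_clinear A"
  shows "((\<lambda>e. g (l e) *\<^sub>R (cinner e (A e) - c)) has_sum
      (op_trace (op_fun V D g \<circ> A) - c * op_trace (op_fun V D g))) E"
proof -
  obtain C where C: "\<And>x. norm (A x) \<le> norm x * C"
    using bounded_linear.bounded[OF bounded_linear_if_bounded_clinear[OF A]] by blast
  have "(\<lambda>e. norm (g (l e) * cinner e (A e))) summable_on E"
  proof (rule summable_on_comparison_test[OF summable_on_cmult_left[OF sum, of C]])
    fix e assume e: "e \<in> E"
    have "cmod (cinner e (A e)) \<le> C"
      using cauchy_schwarz[of e "A e"] C[of e] norm_E[OF e] by simp
    then show "norm (g (l e) * cinner e (A e)) \<le> g (l e) * C"
      using g(1)[OF e] by (simp add: norm_mult mult_left_mono)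
  qed simp
  then have "(\<lambda>e. g (l e) * cinner e (A e)) summable_on E"
    by (rule abs_summable_summable)
  moreover have "op_trace (op_fun V D g \<circ> A) = (\<Sum>\<^sub>\<infinity>e\<in>E. g (l e) * cinner e (A e))"
    using assms by (rule op_trace_op_fun_compose)
  ultimately have "((\<lambda>e. g (l e) * cinner e (A e)) has_sum op_trace (op_fun V D g \<circ> A)) E"
    by simp
  moreover have "op_trace (op_fun V D g) = complex_of_real (\<Sum>\<^sub>\<infinity>e\<in>E. g (l e))"
    using g sum by (rule op_trace_op_fun)
  then have "((\<lambda>e. complex_of_real (g (l e))) has_sum op_trace (op_fun V D g)) E"
    by (simp only:) (intro has_sum_of_real has_sum_infsum sum)
  then have "((\<lambda>e. - c * complex_of_real (g (l e))) has_sum - c * op_trace (op_fun V D g)) E"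
    by (rule has_sum_cmult_right)
  ultimately have "((\<lambda>e. g (l e) * cinner e (A e) + - c * complex_of_real (g (l e))) has_sum
      (op_trace (op_fun V D g \<circ> A) + - c * op_trace (op_fun V D g))) E"
    by (rule has_sum_add)
  then show ?thesis
    by (simp add: scaleR_conv_of_real algebra_simps)
qed

end

lemma square_powr_half:
  fixes x :: real
  assumes "x \<noteq> 0"
  shows "(x\<^sup>2) powr (- (s / 2)) = \<bar>x\<bar> powr (- s)"
proof -
  have "x\<^sup>2 = \<bar>x\<bar> powr 2"
    using assms by simp
  then show ?thesis
    by (simp only: powr_powr) simp
qed

theorem corollary2p4:
  fixes \<A> :: "('h::complex_hilbert_space \<Rightarrow> 'h) set"
    and V :: "'h set" and D A :: "'h \<Rightarrow> 'h"
    and f :: "real \<Rightarrow> real" and \<alpha> :: real and c :: complex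
  assumes "spectral_triple \<A> V D"
    and "compact_inverse V D"
    and "\<And>t. t > 0 \<Longrightarrow> trace_class (heat_op V D t)"
    and "\<alpha> < 0"
    and "bounded (f ` {0..})"
    and "\<And>b. f absolutely_integrable_on {0..b}"
    and "\<exists>L. L \<noteq> 0 \<and> ((\<lambda>s. s * laplace f s) \<longlongrightarrow> L) (at_right 0)"
    and "(\<lambda>t. op_trace (heat_op V D t)) \<sim>[at_right 0]
           (\<lambda>t. complex_of_real (f (- ln t) * t powr \<alpha>))"
    and "bounded_clinear A"
    and "strongly_regular V D A c"
  shows "(zeta_quotient V D A \<longlongrightarrow> c) (at_right (zeta_abscissa V D)) \<and>
     c = spec_state V D A \<and>
     (\<lambda>t. op_trace (heat_op V D t \<circ> A) - spec_state V D A * op_trace (heat_op V D t))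
           \<in> o[at_right 0](\<lambda>t. op_trace (heat_op V D t)) \<and>
     (spec_state V D A \<noteq> 0 \<longrightarrow>
           (\<lambda>t. op_trace (heat_op V D t \<circ> A)) \<sim>[at_right 0]
           (\<lambda>t. spec_state V D A * op_trace (heat_op V D t))) \<and>
     (\<lambda>t. op_trace (heat_op V D t \<circ> A)
            - spec_state V D A * complex_of_real (f (- ln t)) * complex_of_real (t powr \<alpha>))
           \<in> o[at_right 0](\<lambda>t. op_trace (heat_op V D t))"
proof -
  have sa: "self_adjoint V D"
    using assms(1) by (simp add: spectral_triple_def)
  obtain E l m where "eigenbasis V D E l m"
    using eigenbasis_exists[OF sa assms(2)] .
  then interpret eigenbasis V D E l m .
  note spectral_gap = gap
  define a where "a = - \<alpha>"
  have a: "a > 0"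
    using assms(4) by (simp add: a_def)
  have heat_bounds: "0 < exp (- t * (l e)\<^sup>2)" "0 \<le> exp (- t * (l e)\<^sup>2)" "exp (- t * (l e)\<^sup>2) \<le> 1"
    if "t > 0" for t e
    using that by auto
  have heat_sum: "(\<lambda>e. exp (- t * (l e)\<^sup>2)) summable_on E" if "t > 0" for t
    using trace_class_op_fun_iff[of "\<lambda>x. exp (- t * x\<^sup>2)" 1] heat_bounds[OF that] assms(3)[OF that]
    unfolding heat_op_def by blast
  \<comment> \<open>A summable real family has only countably many nonzero terms, and here no term
    vanishes.\<close>
  have "{e \<in> E. exp (- 1 * (l e)\<^sup>2) \<noteq> 0} = E"
    by auto
  then have E: "countable E"
    using summable_countable_real[OF heat_sum[of 1]] by simp

  \<comment> \<open>Enumeration of the spectrum\<close>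
  define N where "N = to_nat_on E ` E"
  define idx where "idx = from_nat_into E"
  have idx: "idx n \<in> E" if "n \<in> N" for n
    using that E by (auto simp: N_def idx_def)
  define p :: "nat \<Rightarrow> real" where "p n = (if n \<in> N then 1 else 0)" for n
  \<comment> \<open>The default \<open>m\<^sup>2\<close> on padding indices preserves the spectral
    gap; \<open>p\<close> and \<open>b\<close> vanish there.\<close>
  define \<mu> where "\<mu> n = (if n \<in> N then (l (idx n))\<^sup>2 else m\<^sup>2)" for n
  define b where "b n = (if n \<in> N then cinner (idx n) (A (idx n)) - c else 0)" for n
  have l_nz: "l e \<noteq> 0" if "e \<in> E" for e
    using gap that by fastforce
  have heat_enum: "(\<lambda>n. p n * exp (- t * \<mu> n))
      = (\<lambda>n. if n \<in> to_nat_on E ` E then exp (- t * (l (from_nat_into E n))\<^sup>2) else 0)" for t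
    by (auto simp: p_def \<mu>_def N_def idx_def)
  have zeta_enum: "(\<lambda>n. p n * \<mu> n powr (- (s / 2)))
      = (\<lambda>n. if n \<in> to_nat_on E ` E then \<bar>l (from_nat_into E n)\<bar> powr (- s) else 0)" for s
    using idx l_nz by (auto simp: p_def \<mu>_def N_def idx_def square_powr_half)
  interpret heat_series p \<mu> "m\<^sup>2"
  proof
    show "0 \<le> p n" for n
      by (simp add: p_def)
    show "0 < m\<^sup>2"
      using gap(1) by simp
    show "m\<^sup>2 \<le> \<mu> n" for n
    proof -
      have "m\<^sup>2 \<le> \<bar>l (idx n)\<bar>\<^sup>2" if "n \<in> N"
        using gap idx[OF that] by (intro power_mono) auto
      then show ?thesis
        by (simp add: \<mu>_def)
    qed
    show "summable (\<lambda>n. p n * exp (- t * \<mu> n))" if "0 < t" for t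
      unfolding heat_enum using heat_sum[OF that] by (subst summable_enumerate_iff[OF E, symmetric]) auto
  qed

  \<comment> \<open>Heat and zeta traces as series\<close>
  have heat_trace: "op_trace (heat_op V D t) = complex_of_real (heat t)" if "t > 0" for t
  proof -
    have "heat t = (\<Sum>\<^sub>\<infinity>e\<in>E. exp (- t * (l e)\<^sup>2))"
      unfolding heat_def heat_enum
      by (rule sums_unique[OF sums_enumerate[OF E has_sum_infsum[OF heat_sum[OF that]]], symmetric])
    then show ?thesis
      unfolding heat_op_def
      using op_trace_op_fun[of "\<lambda>x. exp (- t * x\<^sup>2)" 1, OF heat_bounds(2,3)[OF that] heat_sum[OF that]]
      by simp
  qed
  have heat_diff: "op_trace (heat_op V D t \<circ> A) - c * op_trace (heat_op V D t) = (\<Sum>n. exp (- t * \<mu> n) *\<^sub>R b n)"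
    if "t > 0" for t
  proof -
    have "(\<lambda>n. if n \<in> to_nat_on E ` E then exp (- t * (l (from_nat_into E n))\<^sup>2) *\<^sub>R
          (cinner (from_nat_into E n) (A (from_nat_into E n)) - c) else 0)
        sums (op_trace (heat_op V D t \<circ> A) - c * op_trace (heat_op V D t))"
      unfolding heat_op_def
      by (rule sums_enumerate[OF E op_fun_has_sum[of "\<lambda>x. exp (- t * x\<^sup>2)" 1,
            OF heat_bounds(2,3)[OF that] heat_sum[OF that] assms(9)]])
    moreover have "(\<lambda>n. exp (- t * \<mu> n) *\<^sub>R b n) = (\<lambda>n. if n \<in> to_nat_on E ` E
        then exp (- t * (l (from_nat_into E n))\<^sup>2) *\<^sub>R
          (cinner (from_nat_into E n) (A (from_nat_into E n)) - c) else 0)"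
      by (auto simp: b_def \<mu>_def N_def idx_def)
    ultimately show ?thesis
      by (simp add: sums_iff)
  qed

  have power_bounds: "0 < \<bar>l e\<bar> powr (- s)" "0 \<le> \<bar>l e\<bar> powr (- s)" "\<bar>l e\<bar> powr (- s) \<le> m powr (- s)"
    if "s > 0" "e \<in> E" for s e
    using that l_nz[OF that(2)] spectral_gap by (auto intro!: powr_mono2')
  have trace_class_iff: "trace_class (abs_power V D s) \<longleftrightarrow> summable (\<lambda>n. p n * \<mu> n powr (- (s / 2)))"
    if "s > 0" for s
    unfolding abs_power_def zeta_enum
    using trace_class_op_fun_iff[of "\<lambda>x. \<bar>x\<bar> powr (- s)" "m powr (- s)"] power_bounds[OF that]
      summable_enumerate_iff[OF E, of "\<lambda>e. \<bar>l e\<bar> powr (- s)"] by simp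
  have power_sum: "(\<lambda>e. \<bar>l e\<bar> powr (- s)) summable_on E"
    if "s > 0" "summable (\<lambda>n. p n * \<mu> n powr (- (s / 2)))" for s
    using that(2) summable_enumerate_iff[OF E, of "\<lambda>e. \<bar>l e\<bar> powr (- s)"] unfolding zeta_enum by simp
  have zeta_trace: "spec_zeta V D s = complex_of_real (zeta (s / 2))"
    if s: "s > 0" and sum: "summable (\<lambda>n. p n * \<mu> n powr (- (s / 2)))" for s
  proof -
    have "zeta (s / 2) = (\<Sum>\<^sub>\<infinity>e\<in>E. \<bar>l e\<bar> powr (- s))"
      unfolding zeta_def zeta_enum
      by (rule sums_unique[OF sums_enumerate[OF E has_sum_infsum[OF power_sum[OF that]]], symmetric])
    then show ?thesis
      unfolding spec_zeta_def abs_power_def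
      using op_trace_op_fun[of "\<lambda>x. \<bar>x\<bar> powr (- s)" "m powr (- s)", OF power_bounds(2,3)[OF s] power_sum[OF that]]
      by simp
  qed
  have zeta_diff: "op_trace (abs_power V D s \<circ> A) - c * spec_zeta V D s = (\<Sum>n. \<mu> n powr (- (s / 2)) *\<^sub>R b n)"
    if s: "s > 0" and sum: "summable (\<lambda>n. p n * \<mu> n powr (- (s / 2)))" for s
  proof -
    have "(\<lambda>n. if n \<in> to_nat_on E ` E then \<bar>l (from_nat_into E n)\<bar> powr (- s) *\<^sub>R
          (cinner (from_nat_into E n) (A (from_nat_into E n)) - c) else 0)
        sums (op_trace (abs_power V D s \<circ> A) - c * spec_zeta V D s)"
      unfolding abs_power_def spec_zeta_def
      by (rule sums_enumerate[OF E op_fun_has_sum[of "\<lambda>x. \<bar>x\<bar> powr (- s)" "m powr (- s)",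
            OF power_bounds(2,3)[OF s] power_sum[OF that] assms(9)]])
    moreover have "(\<lambda>n. \<mu> n powr (- (s / 2)) *\<^sub>R b n) = (\<lambda>n. if n \<in> to_nat_on E ` E
        then \<bar>l (from_nat_into E n)\<bar> powr (- s) *\<^sub>R
          (cinner (from_nat_into E n) (A (from_nat_into E n)) - c) else 0)"
      using idx l_nz by (auto simp: b_def \<mu>_def N_def idx_def square_powr_half)
    ultimately show ?thesis
      by (simp add: sums_iff)
  qed

  \<comment> \<open>Growth of the heat trace and divergence of zeta\<close>
  have trace_f: "(\<lambda>t. op_trace (heat_op V D t) - complex_of_real (f (- ln t) * t powr \<alpha>))
      \<in> o[at_right 0](\<lambda>t. complex_of_real (f (- ln t) * t powr \<alpha>))"
    using assms(8) by (rule asymp_equiv_imp_diff_smallo)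
  \<comment> \<open>Relative error 1/2 gives comparison in both directions: the heat trace is at
    most 3/2 of |f| exp (a x), which yields convergence of zeta, and |f| exp (a x) is at most twice
    the heat trace, which yields divergence at a.\<close>
  obtain X where X: "X \<ge> 0" "\<And>x. x \<ge> X \<Longrightarrow>
      \<bar>heat (exp (- x)) - f x * exp (a * x)\<bar> \<le> 1 / 2 * \<bar>f x * exp (a * x)\<bar>"
  proof -
    have "\<forall>\<^sub>F t in at_right 0. norm (op_trace (heat_op V D t) - complex_of_real (f (- ln t) * t powr \<alpha>))
        \<le> 1 / 2 * norm (complex_of_real (f (- ln t) * t powr \<alpha>))"
      by (rule landau_o.smallD[OF trace_f]) simp
    from eventually_at_right_0_exp_minus[OF this] obtain X where X: "X \<ge> 0 \<and> (\<forall>x\<ge>X.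
        norm (op_trace (heat_op V D (exp (- x))) - complex_of_real (f (- ln (exp (- x))) * exp (- x) powr \<alpha>))
        \<le> 1 / 2 * norm (complex_of_real (f (- ln (exp (- x))) * exp (- x) powr \<alpha>)))"
      by (rule exE)
    have "exp (- x) powr \<alpha> = exp (a * x)" for x
      by (simp add: a_def powr_def mult.commute)
    then have "\<bar>heat (exp (- x)) - f x * exp (a * x)\<bar> \<le> 1 / 2 * \<bar>f x * exp (a * x)\<bar>" if "x \<ge> X" for x
      using X[THEN conjunct2, rule_format, OF that]
      unfolding heat_trace[OF exp_gt_zero] of_real_diff[symmetric] norm_of_real by simp
    then show ?thesis
      using that X by blast
  qed
  obtain M where M: "\<And>x. x \<ge> 0 \<Longrightarrow> \<bar>f x\<bar> \<le> M"
    using assms(5) unfolding bounded_iff by auto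
  have growth: "heat (exp (- x)) \<le> (3 / 2 * M) * exp (a * x)" if "x \<ge> X" for x
  proof -
    have "heat (exp (- x)) \<le> 3 / 2 * \<bar>f x * exp (a * x)\<bar>"
      using X(2)[OF that] by linarith
    also have "\<dots> \<le> 3 / 2 * (M * exp (a * x))"
      using M[of x] that X(1) by (simp add: abs_mult)
    finally show ?thesis
      by simp
  qed
  have f_le: "\<bar>f x\<bar> \<le> 2 * (heat (exp (- x)) * exp (- a * x))" if "x \<ge> X" for x
  proof -
    have "\<bar>f x * exp (a * x)\<bar> \<le> 2 * heat (exp (- x))"
      using X(2)[OF that] heat_nonneg[OF exp_gt_zero, of "- x"] by linarith
    then have "\<bar>f x\<bar> * exp (a * x) * exp (- a * x) \<le> 2 * heat (exp (- x)) * exp (- a * x)"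
      by (intro mult_right_mono) (auto simp: abs_mult)
    moreover have "exp (a * x) * exp (- a * x) = 1"
      by (simp flip: exp_add)
    ultimately show ?thesis
      by (simp only: mult.assoc mult_1_right)
  qed
  have summable: "summable (\<lambda>n. p n * \<mu> n powr (- w))" if "w > a" for w
    using summable_zeta[OF growth that] that a by simp
  obtain L where L: "L \<noteq> 0" "((\<lambda>s. s * laplace f s) \<longlongrightarrow> L) (at_right 0)"
    using assms(7) by blast
  have zeta_lim: "filterlim zeta at_top (at_right a)"
    by (rule zeta_at_top[OF a summable X(1) f_le assms(6,5) L])

  \<comment> \<open>The abscissa of convergence\<close>
  have "0 < s \<and> trace_class (abs_power V D s) \<longleftrightarrow> 2 * a < s" for s
  proof (cases "s > 2 * a")
    case True
    then show ?thesis
      using a summable[of "s / 2"] trace_class_iff[of s] by simp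
  next
    case False
    then show ?thesis
      using not_summable_zeta[OF zeta_lim _ summable, of "s / 2"] trace_class_iff[of s] by auto
  qed
  then have "{s. 0 < s \<and> trace_class (abs_power V D s)} = {2 * a<..}"
    by auto
  then have abscissa: "zeta_abscissa V D = 2 * a"
    by (simp add: zeta_abscissa_def)

  \<comment> \<open>Convergence of the zeta quotient\<close>
  obtain K where K: "\<And>x. norm (A x) \<le> norm x * K"
    using bounded_linear.bounded[OF bounded_linear_if_bounded_clinear[OF assms(9)]] by blast
  have b_le: "norm (b n) \<le> (K + norm c) * p n" for n
  proof (cases "n \<in> N")
    case True
    have "cmod (cinner (idx n) (A (idx n))) \<le> K"
      using cauchy_schwarz[of "idx n" "A (idx n)"] K[of "idx n"] norm_E[OF idx[OF True]] by simp
    then show ?thesis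
      using True norm_triangle_ineq4[of "cinner (idx n) (A (idx n))" c] by (simp add: b_def p_def)
  qed (simp add: b_def p_def)
  have small: "\<exists>X. \<forall>x\<ge>X. norm (\<Sum>n. exp (- exp (- x) * \<mu> n) *\<^sub>R b n) \<le> \<epsilon> * heat (exp (- x))"
    if "\<epsilon> > 0" for \<epsilon>
  proof -
    have "\<forall>\<^sub>F t in at_right 0. norm (op_trace (heat_op V D t \<circ> A) - c * op_trace (heat_op V D t))
        \<le> \<epsilon> * norm (op_trace (heat_op V D t))"
      by (rule landau_o.smallD[OF assms(10)[unfolded strongly_regular_def] that])
    from eventually_at_right_0_exp_minus[OF this] obtain X where X: "X \<ge> 0 \<and> (\<forall>x\<ge>X.
        norm (op_trace (heat_op V D (exp (- x)) \<circ> A) - c * op_trace (heat_op V D (exp (- x))))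
        \<le> \<epsilon> * norm (op_trace (heat_op V D (exp (- x)))))"
      by (rule exE)
    have "norm (\<Sum>n. exp (- exp (- x) * \<mu> n) *\<^sub>R b n) \<le> \<epsilon> * heat (exp (- x))" if "x \<ge> X" for x
      using X[THEN conjunct2, rule_format, OF that] heat_nonneg[of "exp (- x)"]
      unfolding heat_diff[OF exp_gt_zero] unfolding heat_trace[OF exp_gt_zero] norm_of_real by simp
    then show ?thesis
      by blast
  qed
  have half: "filterlim (\<lambda>s. s / 2) (at_right a) (at_right (2 * a))"
    unfolding filterlim_at
  proof
    show "\<forall>\<^sub>F s in at_right (2 * a). s / 2 \<in> {a<..} \<and> s / 2 \<noteq> a"
      by (rule eventually_mono[OF eventually_at_right_less]) auto
    have "((\<lambda>s. s / 2) \<longlongrightarrow> 2 * a / 2) (at_right (2 * a))"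
      by (intro tendsto_intros) auto
    then show "((\<lambda>s. s / 2) \<longlongrightarrow> a) (at_right (2 * a))"
      by simp
  qed
  have "((\<lambda>s. (\<Sum>n. \<mu> n powr (- (s / 2)) *\<^sub>R b n) / complex_of_real (zeta (s / 2))) \<longlongrightarrow> 0) (at_right (2 * a))"
    using filterlim_compose[OF zeta_quotient_tendsto_0[OF a summable zeta_lim b_le small] half] .
  \<comment> \<open>Dividing \<open>zeta_diff\<close> by zeta needs a nonzero denominator, which its
    divergence guarantees close to the abscissa.\<close>
  moreover have "\<forall>\<^sub>F s in at_right (2 * a).
      (\<Sum>n. \<mu> n powr (- (s / 2)) *\<^sub>R b n) / complex_of_real (zeta (s / 2)) = zeta_quotient V D A s - c"
  proof -
    have "\<forall>\<^sub>F s in at_right (2 * a). zeta (s / 2) > 0"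
      using filterlim_compose[OF zeta_lim half] by (simp add: filterlim_at_top_dense)
    moreover have "\<forall>\<^sub>F s in at_right (2 * a). s > 2 * a"
      by (rule eventually_at_right_less)
    ultimately show ?thesis
    proof eventually_elim
      case (elim s)
      have s: "s > 0" and sum: "summable (\<lambda>n. p n * \<mu> n powr (- (s / 2)))"
        using elim(2) a summable[of "s / 2"] by auto
      show ?case
        unfolding zeta_quotient_def zeta_diff[OF s sum, symmetric] zeta_trace[OF s sum]
        using elim(1) by (simp add: diff_divide_distrib)
    qed
  qed
  ultimately have "((\<lambda>s. zeta_quotient V D A s - c) \<longlongrightarrow> 0) (at_right (2 * a))"
    by (simp add: filterlim_cong)
  then have lim: "(zeta_quotient V D A \<longlongrightarrow> c) (at_right (zeta_abscissa V D))"
    unfolding abscissa by (simp add: LIM_zero_iff)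
  have state: "spec_state V D A = c"
    unfolding spec_state_def using lim by (intro tendsto_Lim) auto

  \<comment> \<open>Asymptotics of the heat trace with A\<close>
  have regular: "(\<lambda>t. op_trace (heat_op V D t \<circ> A) - c * op_trace (heat_op V D t))
      \<in> o[at_right 0](\<lambda>t. op_trace (heat_op V D t))"
    using assms(10) by (simp add: strongly_regular_def)
  have equiv: "(\<lambda>t. op_trace (heat_op V D t \<circ> A)) \<sim>[at_right 0] (\<lambda>t. c * op_trace (heat_op V D t))"
    if "c \<noteq> 0"
    using regular that by (intro smallo_imp_asymp_equiv) simp
  \<comment> \<open>Symmetry of the equivalence measures this error against the heat trace instead
    of f. Adding -c times it to the strong regularity difference cancels the heat trace and leaves f
    in its place.\<close>
  have "(\<lambda>t. complex_of_real (f (- ln t) * t powr \<alpha>) - op_trace (heat_op V D t))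
      \<in> o[at_right 0](\<lambda>t. op_trace (heat_op V D t))"
    using assms(8) by (intro asymp_equiv_imp_diff_smallo) (rule asymp_equiv_symI)
  then have "(\<lambda>t. - c * (complex_of_real (f (- ln t) * t powr \<alpha>) - op_trace (heat_op V D t)))
      \<in> o[at_right 0](\<lambda>t. op_trace (heat_op V D t))"
    by (cases "c = 0") simp_all
  from sum_in_smallo(1)[OF regular this]
  have "(\<lambda>t. op_trace (heat_op V D t \<circ> A) - c * complex_of_real (f (- ln t)) * complex_of_real (t powr \<alpha>))
      \<in> o[at_right 0](\<lambda>t. op_trace (heat_op V D t))"
    by (simp add: algebra_simps)
  then show ?thesis
    using lim regular equiv unfolding state by blast
qed

end
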